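(* Let $G$ be a graph and $\theta$ a real number with $\mathrm{mult}(\theta,G)\ge2$, and let $H_1,\dots,H_q$ be the $\theta$-critical components of $G\setminus A_\theta(G)$. For distinct vertices $u,v$, $\mathrm{mult}(\theta,S_\theta(G)\setminus\{u,v\})=\mathrm{mult}(\theta,S_\theta(G))-2$ if and only if $u\in V(H_i)$ and $v\in V(H_j)$ for some $i\neq j$.
   Context: All graphs are finite and simple. For a graph $G$ on $n$ vertices, let $p(G,r)$ be the number of $r$-matchings of $G$ ($p(G,0)=1$); the matching polynomial is $\mu(G,x)=\sum_{r=0}^{\lfloor n/2\rfloor}(-1)^r p(G,r)x^{n-2r}$. For real $\theta$, $\mathrm{mult}(\theta,G)$ is the multiplicity of $\theta$ as a root of $\mu(G,x)$. $G\setminus X$ denotes deletion of the vertex set $X$; $G\setminus u=G\setminus\{u\}$. A vertex $u$ is $\theta$-essential in $G$ if $\mathrm{mult}(\theta,G\setminus u)=\mathrm{mult}(\theta,G)-1$. A vertex is $\theta$-special if it is not $\theta$-essential but is adjacent to a $\theta$-essential vertex; $A_\theta(G)$ is the set of $\theta$-special vertices. A connected graph is $\theta$-critical if all its vertices are $\theta$-essential in it. $S_\theta(G)$ is the graph on $V(G)$ whose edges are the edges of $G$ together with all pairs $\{w,z\}$, $z\neq w$, with $w\in A_\theta(G)$. *)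

theory Defs
  imports "HOL-Computational_Algebra.Polynomial"
begin

type_synonym 'a graph = "'a set \<times> 'a set set"

definition verts :: "'a graph \<Rightarrow> 'a set" where "verts G = fst G"
definition edges :: "'a graph \<Rightarrow> 'a set set" where "edges G = snd G"

definition graph :: "'a graph \<Rightarrow> bool" where
  "graph G \<longleftrightarrow> finite (verts G) \<and>
     (\<forall>e\<in>edges G. \<exists>x y. x \<noteq> y \<and> x \<in> verts G \<and> y \<in> verts G \<and> e = {x, y})"

definition is_matching :: "'a set set \<Rightarrow> bool" where
  "is_matching M \<longleftrightarrow> (\<forall>e1\<in>M. \<forall>e2\<in>M. e1 \<noteq> e2 \<longrightarrow> e1 \<inter> e2 = {})"

definition num_match :: "'a graph \<Rightarrow> nat \<Rightarrow> nat" where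
  "num_match G r = card {M. M \<subseteq> edges G \<and> is_matching M \<and> card M = r}"

definition match_poly :: "'a graph \<Rightarrow> real poly" where
  "match_poly G = (\<Sum>r\<le>card (verts G) div 2.
      monom ((-1) ^ r * real (num_match G r)) (card (verts G) - 2 * r))"

definition mult :: "real \<Rightarrow> 'a graph \<Rightarrow> nat" where
  "mult \<theta> G = order \<theta> (match_poly G)"

definition del :: "'a graph \<Rightarrow> 'a set \<Rightarrow> 'a graph" where
  "del G X = (verts G - X, {e \<in> edges G. e \<inter> X = {}})"

definition essential :: "real \<Rightarrow> 'a graph \<Rightarrow> 'a \<Rightarrow> bool" where
  "essential \<theta> G u \<longleftrightarrow> u \<in> verts G \<and>
     int (mult \<theta> (del G {u})) = int (mult \<theta> G) - 1"

definition special :: "real \<Rightarrow> 'a graph \<Rightarrow> 'a \<Rightarrow> bool" where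
  "special \<theta> G u \<longleftrightarrow> u \<in> verts G \<and> \<not> essential \<theta> G u \<and>
     (\<exists>w. {u, w} \<in> edges G \<and> essential \<theta> G w)"

definition A_set :: "real \<Rightarrow> 'a graph \<Rightarrow> 'a set" where
  "A_set \<theta> G = {u. special \<theta> G u}"

definition adj :: "'a graph \<Rightarrow> 'a \<Rightarrow> 'a \<Rightarrow> bool" where
  "adj G x y \<longleftrightarrow> {x, y} \<in> edges G"

definition connected_graph :: "'a graph \<Rightarrow> bool" where
  "connected_graph G \<longleftrightarrow> verts G \<noteq> {} \<and>
     (\<forall>x\<in>verts G. \<forall>y\<in>verts G. (adj G)\<^sup>*\<^sup>* x y)"

definition components :: "'a graph \<Rightarrow> 'a set set" where
  "components G = {{y \<in> verts G. (adj G)\<^sup>*\<^sup>* x y} | x. x \<in> verts G}"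

definition induced :: "'a graph \<Rightarrow> 'a set \<Rightarrow> 'a graph" where
  "induced G C = (C, {e \<in> edges G. e \<subseteq> C})"

definition critical :: "real \<Rightarrow> 'a graph \<Rightarrow> bool" where
  "critical \<theta> G \<longleftrightarrow> connected_graph G \<and> (\<forall>u\<in>verts G. essential \<theta> G u)"

definition crit_comps :: "real \<Rightarrow> 'a graph \<Rightarrow> 'a set set" where
  "crit_comps \<theta> G = {C \<in> components (del G (A_set \<theta> G)).
      critical \<theta> (induced (del G (A_set \<theta> G)) C)}"

definition S_graph :: "real \<Rightarrow> 'a graph \<Rightarrow> 'a graph" where
  "S_graph \<theta> G = (verts G, edges G \<union>
      {{w, z} | w z. w \<in> A_set \<theta> G \<and> z \<in> verts G \<and> z \<noteq> w})"

end

theory Submission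
  imports Defs
begin

text \<open>
  Write \<open>\<mu> V\<close> for the matching polynomial of the subgraph induced by \<open>V\<close> and \<open>m V\<close> for the multiplicity of
  \<open>\<theta>\<close>. By the Heilmann--Lieb identity, \<open>\<mu> (V - {x}) * \<mu> (V - {y}) - \<mu> V * \<mu> (V - {x, y})\<close> is a sum of the
  squares of \<open>\<mu> (V - P)\<close> over the paths \<open>P\<close> from \<open>x\<close> to \<open>y\<close>; this gives interlacing and parity constraints
  on multiplicities. A three-vertex analogue, whose right-hand side consists of products
  \<open>\<mu> (V - P) * \<mu> (V - P - {z})\<close> with nonnegative lowest coefficients, excludes the remaining bad patterns of
  multiplicities. It yields both the stability lemma (deleting a special vertex raises \<open>m\<close> and keeps the
  set of essential vertices) and Gallai's lemma (\<open>m = 1\<close> for a critical graph).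

  Stability shows that the essential vertices are exactly those in the critical components of
  \<open>G - A\<close>, and that adding edges at special vertices changes neither \<open>m\<close> nor the essential vertices. If \<open>u\<close>
  is essential, then \<open>S - u\<close> has multiplicity at least 1, hence an essential vertex, to which all of \<open>A\<close> is
  adjacent in \<open>S\<close>; so \<open>A\<close> stays special in \<open>S - u\<close> and \<open>v\<close> is essential there iff it is in \<open>G - A - u\<close>. Since
  deleting \<open>u\<close> makes the multiplicity of its own critical component 0, the latter means that \<open>v\<close> lies in
  another critical component.
\<close>

section \<open>Recursion for the matching polynomial\<close>

text \<open>With the adjacency relation fixed and only the vertex set varying, deleting vertices
  becomes set difference, and the inductions run over finite sets.\<close>

definition graph_on :: "('a \<Rightarrow> 'a \<Rightarrow> bool) \<Rightarrow> 'a set \<Rightarrow> 'a graph" where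
  "graph_on E V = (V, {{x, y} | x y. x \<in> V \<and> y \<in> V \<and> E x y})"

lemma verts_graph_on [simp]: "verts (graph_on E V) = V"
  by (simp add: graph_on_def verts_def)

lemma edges_graph_on: "edges (graph_on E V) = {{x, y} | x y. x \<in> V \<and> y \<in> V \<and> E x y}"
  by (simp add: graph_on_def edges_def)

lemma graph_on_cong:
  assumes "\<And>x y. x \<in> V \<Longrightarrow> y \<in> V \<Longrightarrow> E x y \<longleftrightarrow> F x y"
  shows "graph_on E V = graph_on F V"
  unfolding graph_on_def using assms by (metis (lifting))

lemma del_graph_on: "del (graph_on E V) X = graph_on E (V - X)"
  unfolding del_def graph_on_def verts_def edges_def fst_conv snd_conv
  by (rule arg_cong2[of _ _ _ _ Pair]) blast+

lemma induced_graph_on: "D \<subseteq> V \<Longrightarrow> induced (graph_on E V) D = graph_on E D"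
  unfolding induced_def graph_on_def edges_def snd_conv
  by (rule arg_cong2[of _ _ _ _ Pair]) blast+

definition matchings :: "'a graph \<Rightarrow> 'a set set set" where
  "matchings G = {M. M \<subseteq> edges G \<and> is_matching M}"

lemma finite_matchings:
  assumes "graph G" shows "finite (matchings G)"
proof -
  have "edges G \<subseteq> Pow (verts G)" using assms by (auto simp: graph_def)
  then have "finite (edges G)" using assms by (meson finite_Pow_iff finite_subset graph_def)
  then show ?thesis unfolding matchings_def by (simp add: finite_subset[of _ "Pow (edges G)"] subset_iff)
qed

lemma card_matching_le:
  assumes "graph G" "M \<in> matchings G"
  shows "2 * card M \<le> card (verts G)"
proof -
  have M: "M \<subseteq> edges G" "is_matching M" using assms by (auto simp: matchings_def)
  have e: "\<exists>x y. x \<noteq> y \<and> x \<in> verts G \<and> y \<in> verts G \<and> e = {x,y}" if "e \<in> M" for e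
    using that assms M by (auto simp: graph_def)
  have fin: "finite e \<and> card e = 2 \<and> e \<subseteq> verts G" if "e \<in> M" for e
    using e[OF that] by (auto simp: card_2_iff)
  have "card (\<Union>M) = (\<Sum>e\<in>M. card e)"
    using M fin by (intro card_Union_disjoint) (auto simp: is_matching_def pairwise_def disjnt_def)
  also have "\<dots> = 2 * card M" using fin by simp
  finally have "2 * card M = card (\<Union>M)" by simp
  also have "\<dots> \<le> card (verts G)" using fin assms by (intro card_mono) (auto simp: graph_def)
  finally show ?thesis .
qed

text \<open>Grouping by size gives the definition back; no matching is lost to the cutoff, since the
  edges of a matching cover twice as many vertices. In this form an edge can be split off from a
  matching.\<close>

lemma match_poly_matchings:
  assumes "graph G"
  shows "match_poly G = (\<Sum>M\<in>matchings G. monom ((-1) ^ card M) (card (verts G) - 2 * card M))"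
proof -
  let ?n = "card (verts G)"
  have "(\<Sum>M\<in>matchings G. monom ((-1) ^ card M) (?n - 2 * card M)) =
    (\<Sum>r\<le>?n div 2. \<Sum>M | M \<in> matchings G \<and> card M = r. monom ((-1) ^ card M) (?n - 2 * card M) :: real poly)"
    by (rule sum.group[symmetric])
      (use finite_matchings[OF assms] in simp, simp, use card_matching_le[OF assms] in fastforce)
  also have "\<dots> = match_poly G" unfolding match_poly_def
  proof (rule sum.cong[OF refl])
    fix r assume "r \<in> {..?n div 2}"
    have "(\<Sum>M | M \<in> matchings G \<and> card M = r. monom ((-1) ^ card M) (?n - 2 * card M) :: real poly)
      = (\<Sum>M | M \<in> matchings G \<and> card M = r. monom ((-1) ^ r) (?n - 2 * r))"
      by (rule sum.cong) auto
    also have "\<dots> = of_nat (card {M \<in> matchings G. card M = r}) * monom ((-1) ^ r) (?n - 2 * r)"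
      by simp
    also have "card {M \<in> matchings G. card M = r} = num_match G r"
      by (simp add: matchings_def num_match_def)
    finally show "(\<Sum>M | M \<in> matchings G \<and> card M = r. monom ((-1) ^ card M) (?n - 2 * card M) :: real poly)
      = monom ((-1) ^ r * real (num_match G r)) (?n - 2 * r)"
      by (simp add: of_nat_poly smult_monom mult.commute)
  qed
  finally show ?thesis by simp
qed

locale matching_graph =
  fixes E :: "'a \<Rightarrow> 'a \<Rightarrow> bool"
  assumes sym: "E x y \<Longrightarrow> E y x" and irrefl: "\<not> E x x"
begin

abbreviation \<mu> :: "'a set \<Rightarrow> real poly" where "\<mu> V \<equiv> match_poly (graph_on E V)"

lemma graph_graph_on: "finite V \<Longrightarrow> graph (graph_on E V)"
  unfolding graph_def edges_graph_on verts_graph_on using irrefl by (smt (verit) mem_Collect_eq)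

lemma edge_iff: "{x, y} \<in> edges (graph_on E V) \<longleftrightarrow> x \<in> V \<and> y \<in> V \<and> E x y"
  unfolding edges_graph_on using sym by (auto simp: doubleton_eq_iff)

text \<open>A matching either misses \<open>u\<close> or contains exactly one edge
  \<open>{u, c}\<close>, and without that edge it is a matching of
  \<open>V - {u, c}\<close>.\<close>

lemma matchings_rec:
  assumes "finite V" "u \<in> V"
  shows "matchings (graph_on E V) = matchings (graph_on E (V - {u})) \<union>
    (\<Union>c\<in>{c\<in>V. E u c}. insert {u, c} ` matchings (graph_on E (V - {u, c})))"
proof (intro equalityI subsetI)
  fix M assume "M \<in> matchings (graph_on E V)"
  then have M: "M \<subseteq> edges (graph_on E V)" "is_matching M" by (auto simp: matchings_def)
  show "M \<in> matchings (graph_on E (V - {u})) \<union>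
    (\<Union>c\<in>{c\<in>V. E u c}. insert {u, c} ` matchings (graph_on E (V - {u, c})))"
  proof (cases "u \<in> \<Union>M")
    case False
    then have "M \<subseteq> edges (graph_on E (V - {u}))" using M(1) unfolding edges_graph_on by fast
    then show ?thesis using M by (auto simp: matchings_def)
  next
    case True
    then obtain e where e: "e \<in> M" "u \<in> e" by auto
    then obtain x y where xy: "x \<in> V" "y \<in> V" "E x y" "e = {x,y}" using M unfolding edges_graph_on by blast
    obtain c where c: "c \<in> V" "E u c" "e = {u,c}" using xy e sym by auto
    have "M - {e} \<subseteq> edges (graph_on E (V - {u,c}))"
    proof
      fix f assume f: "f \<in> M - {e}"
      then have "f \<inter> {u,c} = {}" using M(2) e(1) c(3) unfolding is_matching_def by (metis Diff_iff singletonI)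
      moreover obtain x y where "x \<in> V" "y \<in> V" "E x y" "f = {x,y}" using f M unfolding edges_graph_on by blast
      ultimately show "f \<in> edges (graph_on E (V - {u,c}))" unfolding edges_graph_on by blast
    qed
    moreover have "is_matching (M - {e})" using M by (auto simp: is_matching_def)
    ultimately have "M - {e} \<in> matchings (graph_on E (V - {u,c}))" by (simp add: matchings_def)
    moreover have "M = insert {u,c} (M - {e})" using e c by auto
    ultimately show ?thesis using c by blast
  qed
next
  fix M assume "M \<in> matchings (graph_on E (V - {u})) \<union>
    (\<Union>c\<in>{c\<in>V. E u c}. insert {u, c} ` matchings (graph_on E (V - {u, c})))"
  then consider "M \<in> matchings (graph_on E (V - {u}))" |
    c N where "c \<in> V" "E u c" "N \<in> matchings (graph_on E (V - {u, c}))" "M = insert {u,c} N" by blast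
  then show "M \<in> matchings (graph_on E V)"
  proof cases
    case 1
    moreover have "edges (graph_on E (V - {u})) \<subseteq> edges (graph_on E V)" unfolding edges_graph_on by blast
    ultimately show ?thesis unfolding matchings_def by blast
  next
    case 2
    have N: "N \<subseteq> edges (graph_on E (V - {u, c}))" "is_matching N" using 2 by (auto simp: matchings_def)
    have "f \<inter> {u,c} = {}" if "f \<in> N" for f using N(1) that unfolding edges_graph_on by blast
    then have "is_matching M" using N(2) 2(4) unfolding is_matching_def by blast
    moreover have "N \<subseteq> edges (graph_on E V)" using N(1) unfolding edges_graph_on by blast
    ultimately show ?thesis using 2 assms by (auto simp: matchings_def edge_iff)
  qed
qed

theorem match_poly_rec:
  assumes V: "finite V" and u: "u \<in> V"
  shows "\<mu> V = [:0, 1:] * \<mu> (V - {u}) - (\<Sum>c | c \<in> V \<and> E u c. \<mu> (V - {u, c}))"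
proof -
  let ?n = "card V"
  define t :: "'a set set \<Rightarrow> real poly" where "t = (\<lambda>M. monom ((-1) ^ card M) (?n - 2 * card M))"
  let ?m = "\<lambda>X. matchings (graph_on E (V - X))"
  have fm: "finite (?m X)" for X using V by (simp add: finite_matchings graph_graph_on)
  have eN: "e \<subseteq> V - X" if "N \<in> ?m X" "e \<in> N" for e N X
    using that unfolding matchings_def edges_graph_on by blast
  have Nfin: "finite N" if "N \<in> ?m X" for N X
    by (rule finite_subset[of _ "Pow V"]) (use eN that V in auto)
  have "\<mu> V = (\<Sum>M\<in>matchings (graph_on E V). t M)"
    unfolding t_def using match_poly_matchings[OF graph_graph_on[OF V]] by simp
  also have "\<dots> = (\<Sum>M\<in>?m {u}. t M) + (\<Sum>M\<in>(\<Union>c\<in>{c\<in>V. E u c}. insert {u, c} ` ?m {u, c}). t M)"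
    unfolding matchings_rec[OF V u]
  proof (rule sum.union_disjoint)
    show "?m {u} \<inter> (\<Union>c\<in>{c \<in> V. E u c}. insert {u, c} ` ?m {u, c}) = {}"
      using eN[of _ "{u}"] by blast
  qed (use fm V in auto)
  also have "(\<Sum>M\<in>(\<Union>c\<in>{c\<in>V. E u c}. insert {u, c} ` ?m {u, c}). t M)
     = (\<Sum>c\<in>{c\<in>V. E u c}. \<Sum>M\<in>insert {u, c} ` ?m {u, c}. t M)"
  proof (rule sum.UNION_disjoint)
    show "\<forall>i\<in>{c \<in> V. E u c}. \<forall>j\<in>{c \<in> V. E u c}. i \<noteq> j \<longrightarrow>
       insert {u, i} ` ?m {u, i} \<inter> insert {u, j} ` ?m {u, j} = {}"
    proof (intro ballI impI, rule ccontr)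
      fix i j assume ij: "i \<noteq> j" and "insert {u, i} ` ?m {u, i} \<inter> insert {u, j} ` ?m {u, j} \<noteq> {}"
      then obtain M N where "N \<in> ?m {u,j}" "insert {u,i} M = insert {u,j} N" by blast
      moreover have "{u,i} \<noteq> {u,j}" using ij by (auto simp: doubleton_eq_iff)
      ultimately have "{u,i} \<in> N" "N \<in> ?m {u,j}" by auto
      then show False using eN by fastforce
    qed
  qed (use V fm in auto)
  also have "\<dots> = (\<Sum>c\<in>{c\<in>V. E u c}. - \<mu> (V - {u, c}))"
  proof (rule sum.cong[OF refl])
    fix c assume "c \<in> {c \<in> V. E u c}"
    then have c: "c \<in> V" "E u c" "c \<noteq> u" using irrefl by auto
    have notin: "{u,c} \<notin> N" if "N \<in> ?m {u,c}" for N using eN[OF that] by blast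
    have "(\<Sum>M\<in>insert {u, c} ` ?m {u, c}. t M) = (\<Sum>N\<in>?m {u, c}. t (insert {u,c} N))"
      by (subst sum.reindex) (use notin in \<open>auto intro!: inj_onI dest: insert_ident[THEN iffD1, rotated 2]\<close>)
    also have "\<dots> = (\<Sum>N\<in>?m {u, c}. - monom ((-1) ^ card N) (card (V - {u,c}) - 2 * card N))"
    proof (rule sum.cong[OF refl])
      fix N assume N: "N \<in> ?m {u,c}"
      have "card (insert {u,c} N) = Suc (card N)" using Nfin[OF N] notin[OF N] by simp
      moreover have "card (V - {u,c}) = ?n - 2" using c u V by (simp add: card_Diff_subset)
      ultimately show "t (insert {u,c} N) = - monom ((-1) ^ card N) (card (V - {u,c}) - 2 * card N)"
        by (simp add: t_def minus_monom)
    qed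
    also have "\<dots> = - \<mu> (V - {u,c})"
      using match_poly_matchings[OF graph_graph_on, of "V - {u,c}"] V by (simp add: sum_negf)
    finally show "(\<Sum>M\<in>insert {u, c} ` ?m {u, c}. t M) = - \<mu> (V - {u, c})" .
  qed
  also have "(\<Sum>M\<in>?m {u}. t M) = (\<Sum>M\<in>?m {u}. [:0,1:] * monom ((-1) ^ card M) (card (V - {u}) - 2 * card M))"
  proof (rule sum.cong[OF refl])
    fix N assume N: "N \<in> ?m {u}"
    \<comment> \<open>The size bound keeps the subtraction of natural numbers from truncating, so
      restoring \<open>u\<close> raises the exponent by exactly one.\<close>
    have "2 * card N \<le> card (V - {u})" using card_matching_le[OF graph_graph_on N] V by simp
    moreover have "?n = Suc (card (V - {u}))" using V u by (metis card_Suc_Diff1)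
    ultimately have "?n - 2 * card N = Suc (card (V - {u}) - 2 * card N)" by simp
    then show "t N = [:0,1:] * monom ((-1) ^ card N) (card (V - {u}) - 2 * card N)"
      by (simp add: t_def monom_Suc)
  qed
  also have "\<dots> = [:0,1:] * \<mu> (V - {u})"
    using match_poly_matchings[OF graph_graph_on, of "V - {u}"] V by (simp add: sum_distrib_left)
  finally show ?thesis by (simp add: sum_negf)
qed

lemma match_poly_empty: "\<mu> {} = 1"
proof -
  have "matchings (graph_on E {}) = {{}}" by (auto simp: matchings_def edges_graph_on is_matching_def)
  then show ?thesis by (subst match_poly_matchings) (auto simp: graph_graph_on)
qed

end

section \<open>Path identities\<close>

lemma Diff_Diff_Un: "V - A - B = V - (A \<union> B)"
  by blast

context matching_graph
begin

text \<open>As paths are vertex lists, splitting off the first step matches the recursion at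
  \<open>x\<close>; for \<open>x = y\<close> only the one-vertex path remains and starts the
  inductions.\<close>

definition paths :: "'a set \<Rightarrow> 'a \<Rightarrow> 'a \<Rightarrow> 'a list set" where
  "paths V x y = {p. p \<noteq> [] \<and> hd p = x \<and> last p = y \<and> distinct p \<and> set p \<subseteq> V \<and> successively E p}"

lemma finite_paths:
  assumes "finite V" shows "finite (paths V x y)"
  by (rule finite_subset[OF _ finite_subset_distinct[OF assms]]) (auto simp: paths_def)

lemma paths_same: "x \<in> V \<Longrightarrow> paths V x x = {[x]}"
  unfolding paths_def by (auto simp: neq_Nil_conv split: if_splits)

lemma paths_Cons:
  assumes "x \<in> V" "x \<noteq> y"
  shows "paths V x y = (\<Union>c\<in>{c\<in>V. E x c}. Cons x ` paths (V - {x}) c y)"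
proof (intro equalityI subsetI)
  fix p assume p: "p \<in> paths V x y"
  then obtain q where q: "p = x # q" by (auto simp: paths_def neq_Nil_conv)
  then have "q \<noteq> []" using p assms by (auto simp: paths_def)
  then obtain c r where "q = c # r" by (auto simp: neq_Nil_conv)
  then have "q \<in> paths (V - {x}) c y" "c \<in> V" "E x c"
    using p q by (auto simp: paths_def)
  then show "p \<in> (\<Union>c\<in>{c\<in>V. E x c}. Cons x ` paths (V - {x}) c y)" using q by blast
next
  fix p assume "p \<in> (\<Union>c\<in>{c\<in>V. E x c}. Cons x ` paths (V - {x}) c y)"
  then obtain c q where "c \<in> V" "E x c" "q \<in> paths (V - {x}) c y" "p = x # q" by blast
  then show "p \<in> paths V x y" using assms by (cases q) (auto simp: paths_def)
qed

lemma sum_paths: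
  fixes f :: "'a list \<Rightarrow> real poly"
  assumes V: "finite V" and "x \<in> V" "x \<noteq> y"
  shows "(\<Sum>p\<in>paths V x y. f p) = (\<Sum>c | c \<in> V \<and> E x c. \<Sum>p\<in>paths (V - {x}) c y. f (x # p))"
proof -
  have "(\<Sum>p\<in>paths V x y. f p) = (\<Sum>c | c \<in> V \<and> E x c. \<Sum>p\<in>Cons x ` paths (V - {x}) c y. f p)"
    unfolding paths_Cons[OF assms(2,3)] using V finite_paths
    by (intro sum.UNION_disjoint) (auto simp: paths_def)
  then show ?thesis by (simp add: sum.reindex)
qed

lemma sum_paths_rev:
  fixes f :: "'a set \<Rightarrow> real poly"
  shows "(\<Sum>p\<in>paths V x y. f (set p)) = (\<Sum>p\<in>paths V y x. f (set p))"
proof -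
  have "successively (\<lambda>x y. E y x) p = successively E p" for p
    using sym by (metis (mono_tags, lifting) successively_mono)
  then have "rev p \<in> paths V v u" if "p \<in> paths V u v" for p u v
    using that by (auto simp: paths_def hd_rev last_rev)
  then show ?thesis by (intro sum.reindex_bij_witness[of _ rev rev]) simp_all
qed

text \<open>Expand \<open>\<mu> V\<close> and \<open>\<mu> (V - {y})\<close> at \<open>x\<close>.
  The leading terms cancel, and each neighbour \<open>c\<close> of \<open>x\<close> leaves the same
  expression for \<open>c\<close> and \<open>y\<close> in \<open>V - {x}\<close>, or a square if
  \<open>c = y\<close>: the paths are built step by step.\<close>

lemma two_point_identity:
  assumes "finite V" "x \<in> V" "y \<in> V" "x \<noteq> y"
  shows "\<mu> (V - {x}) * \<mu> (V - {y}) - \<mu> V * \<mu> (V - {x, y}) = (\<Sum>p\<in>paths V x y. \<mu> (V - set p) ^ 2)"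
  using assms
proof (induction "card V" arbitrary: V x rule: less_induct)
  case less
  note V = \<open>finite V\<close> and x = \<open>x \<in> V\<close> and y = \<open>y \<in> V\<close> and xy = \<open>x \<noteq> y\<close>
  let ?N = "{c. c \<in> V \<and> E x c}"
  have card: "card (V - {x}) < card V" using V x by (meson card_Diff1_less)
  have r1: "\<mu> V = [:0, 1:] * \<mu> (V - {x}) - (\<Sum>c\<in>?N. \<mu> (V - {x, c}))"
    using match_poly_rec[OF V x] .
  have "\<mu> (V - {y}) = [:0, 1:] * \<mu> (V - {y} - {x}) - (\<Sum>c | c \<in> V - {y} \<and> E x c. \<mu> (V - {y} - {x, c}))"
    using V x xy by (intro match_poly_rec) auto
  also have "(\<Sum>c | c \<in> V - {y} \<and> E x c. \<mu> (V - {y} - {x, c})) =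
      (\<Sum>c\<in>?N. if c = y then 0 else \<mu> (V - {x, y, c}))"
    using V by (intro sum.mono_neutral_cong_left) (auto simp: Diff_Diff_Un insert_commute)
  finally have r2: "\<mu> (V - {y}) = [:0, 1:] * \<mu> (V - {x, y}) - (\<Sum>c\<in>?N. if c = y then 0 else \<mu> (V - {x, y, c}))"
    by (simp add: Diff_Diff_Un insert_commute)
  have "\<mu> (V - {x}) * \<mu> (V - {y}) - \<mu> V * \<mu> (V - {x, y}) =
      (\<Sum>c\<in>?N. \<mu> (V - {x, c})) * \<mu> (V - {x, y}) - \<mu> (V - {x}) * (\<Sum>c\<in>?N. if c = y then 0 else \<mu> (V - {x, y, c}))"
    unfolding r1 r2 by (simp add: algebra_simps)
  also have "\<dots> = (\<Sum>c\<in>?N. \<mu> (V - {x, c}) * \<mu> (V - {x, y}) - \<mu> (V - {x}) * (if c = y then 0 else \<mu> (V - {x, y, c})))"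
    by (simp add: sum_distrib_left sum_distrib_right sum_subtractf)
  also have "\<dots> = (\<Sum>c\<in>?N. \<Sum>p\<in>paths (V - {x}) c y. \<mu> (V - set (x # p)) ^ 2)"
  proof (rule sum.cong[OF refl])
    fix c assume "c \<in> ?N"
    then have c: "c \<in> V" "c \<noteq> x" using irrefl by auto
    show "\<mu> (V - {x, c}) * \<mu> (V - {x, y}) - \<mu> (V - {x}) * (if c = y then 0 else \<mu> (V - {x, y, c}))
       = (\<Sum>p\<in>paths (V - {x}) c y. \<mu> (V - set (x # p)) ^ 2)"
    proof (cases "c = y")
      case True then show ?thesis using y xy by (simp add: paths_same power2_eq_square)
    next
      case False
      then show ?thesis using less.hyps[OF card, of c] V c y xy
        by (simp add: Diff_Diff_Un insert_commute mult.commute)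
    qed
  qed
  also have "\<dots> = (\<Sum>p\<in>paths V x y. \<mu> (V - set p) ^ 2)"
    by (simp add: sum_paths[OF V x xy])
  finally show ?case .
qed

text \<open>The contribution to the three-vertex identity of the alternating paths between
  \<open>x\<close> and \<open>y\<close> that avoid \<open>z\<close>.\<close>

definition path_sum :: "'a set \<Rightarrow> 'a \<Rightarrow> 'a \<Rightarrow> 'a \<Rightarrow> real poly" where
  "path_sum V x y z = (\<Sum>p\<in>paths (V - {z}) x y. \<mu> (V - set p) * \<mu> (V - insert z (set p)))"

lemma path_sum_commute: "path_sum V x y z = path_sum V y x z"
  unfolding path_sum_def by (rule sum_paths_rev)

lemma path_sum_same: "x \<in> V \<Longrightarrow> x \<noteq> z \<Longrightarrow> path_sum V x x z = \<mu> (V - {x}) * \<mu> (V - {x, z})"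
  by (simp add: path_sum_def paths_same insert_commute)

lemma path_sum_rec:
  assumes "finite V" "x \<in> V" "x \<noteq> y" "x \<noteq> z"
  shows "path_sum V x y z = (\<Sum>c | c \<in> V \<and> E x c. if c = z then 0 else path_sum (V - {x}) c y z)"
proof -
  have "path_sum V x y z = (\<Sum>c | c \<in> V - {z} \<and> E x c. path_sum (V - {x}) c y z)"
    unfolding path_sum_def using assms
    by (subst sum_paths) (auto simp: Diff_Diff_Un insert_commute)
  also have "\<dots> = (\<Sum>c | c \<in> V \<and> E x c. if c = z then 0 else path_sum (V - {x}) c y z)"
    using assms by (intro sum.mono_neutral_cong_left) auto
  finally show ?thesis .
qed

text \<open>Superimpose a matching of \<open>V - {x}\<close> and one of \<open>V - {y, z}\<close>, and switch along the alternating
  path from \<open>x\<close>: the pairs that are not matched up with pairs for \<open>V\<close> and \<open>V - {x, y, z}\<close> are those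
  where the path ends in \<open>y\<close> or \<open>z\<close>.\<close>

lemma three_point_identity:
  assumes "finite V" "x \<in> V" "y \<in> V" "z \<in> V" "x \<noteq> y" "x \<noteq> z" "y \<noteq> z"
  shows "\<mu> (V - {x}) * \<mu> (V - {y, z}) - \<mu> V * \<mu> (V - {x, y, z}) = path_sum V x y z + path_sum V x z y"
  using assms
proof (induction "card V" arbitrary: V x rule: less_induct)
  case less
  note V = \<open>finite V\<close> and x = \<open>x \<in> V\<close> and y = \<open>y \<in> V\<close> and z = \<open>z \<in> V\<close>
    and xy = \<open>x \<noteq> y\<close> and xz = \<open>x \<noteq> z\<close> and yz = \<open>y \<noteq> z\<close>
  let ?N = "{c. c \<in> V \<and> E x c}"
  have card: "card (V - {x}) < card V" using V x by (meson card_Diff1_less)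
  have r1: "\<mu> V = [:0, 1:] * \<mu> (V - {x}) - (\<Sum>c\<in>?N. \<mu> (V - {x, c}))"
    using match_poly_rec[OF V x] .
  have "\<mu> (V - {y, z}) = [:0, 1:] * \<mu> (V - {y, z} - {x})
      - (\<Sum>c | c \<in> V - {y, z} \<and> E x c. \<mu> (V - {y, z} - {x, c}))"
    using V x xy xz by (intro match_poly_rec) auto
  also have "(\<Sum>c | c \<in> V - {y, z} \<and> E x c. \<mu> (V - {y, z} - {x, c})) =
      (\<Sum>c\<in>?N. if c = y \<or> c = z then 0 else \<mu> (V - {x, y, z, c}))"
    using V by (intro sum.mono_neutral_cong_left) (auto simp: Diff_Diff_Un insert_commute)
  finally have r2: "\<mu> (V - {y, z}) = [:0, 1:] * \<mu> (V - {x, y, z})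
      - (\<Sum>c\<in>?N. if c = y \<or> c = z then 0 else \<mu> (V - {x, y, z, c}))"
    by (simp add: Diff_Diff_Un insert_commute)
  have "\<mu> (V - {x}) * \<mu> (V - {y, z}) - \<mu> V * \<mu> (V - {x, y, z}) =
      (\<Sum>c\<in>?N. \<mu> (V - {x, c})) * \<mu> (V - {x, y, z})
      - \<mu> (V - {x}) * (\<Sum>c\<in>?N. if c = y \<or> c = z then 0 else \<mu> (V - {x, y, z, c}))"
    unfolding r1 r2 by (simp add: algebra_simps)
  also have "\<dots> = (\<Sum>c\<in>?N. \<mu> (V - {x, c}) * \<mu> (V - {x, y, z})
      - \<mu> (V - {x}) * (if c = y \<or> c = z then 0 else \<mu> (V - {x, y, z, c})))"
    by (simp add: sum_distrib_left sum_distrib_right sum_subtractf)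
  also have "\<dots> = (\<Sum>c\<in>?N. (if c = z then 0 else path_sum (V - {x}) c y z)
      + (if c = y then 0 else path_sum (V - {x}) c z y))"
  proof (rule sum.cong[OF refl])
    fix c assume "c \<in> ?N"
    then have c: "c \<in> V" "c \<noteq> x" using irrefl by auto
    \<comment> \<open>A path whose second vertex is \<open>y\<close> or \<open>z\<close> stops there
      and gives the value in \<open>path_sum_same\<close>; otherwise the induction hypothesis
      applies to \<open>c\<close> in \<open>V - {x}\<close>.\<close>
    consider "c = y" | "c = z" | "c \<noteq> y" "c \<noteq> z" by auto
    then show "\<mu> (V - {x, c}) * \<mu> (V - {x, y, z})
      - \<mu> (V - {x}) * (if c = y \<or> c = z then 0 else \<mu> (V - {x, y, z, c}))
       = (if c = z then 0 else path_sum (V - {x}) c y z) + (if c = y then 0 else path_sum (V - {x}) c z y)"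
    proof cases
      case 1 then show ?thesis using y xy yz
        by (simp add: path_sum_same Diff_Diff_Un insert_commute)
    next
      case 2 then show ?thesis using z xz yz
        by (simp add: path_sum_same Diff_Diff_Un insert_commute)
    next
      case 3
      then show ?thesis using less.hyps[OF card, of c] V c y z xy xz yz
        by (simp add: Diff_Diff_Un insert_commute mult.commute)
    qed
  qed
  also have "\<dots> = path_sum V x y z + path_sum V x z y"
    using V x xy xz by (simp add: path_sum_rec sum.distrib)
  finally show ?case .
qed

end

section \<open>Multiplicities under vertex deletion\<close>

lemma pderiv_sum: "pderiv (\<Sum>i\<in>I. f i) = (\<Sum>i\<in>I. pderiv (f i))"
  by (induction I rule: infinite_finite_induct) (simp_all add: pderiv_add)

lemma order_diff_less:
  fixes p q :: "real poly"
  assumes "p \<noteq> 0" "q \<noteq> 0" "order a p \<noteq> order a q"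
  shows "p - q \<noteq> 0 \<and> order a (p - q) = min (order a p) (order a q)"
proof -
  have *: "p - q \<noteq> 0 \<and> order a (p - q) = order a p" if "p \<noteq> 0" "q \<noteq> 0" "order a p < order a q" for p q :: "real poly"
  proof -
    let ?n = "order a p"
    have p: "[:-a, 1:] ^ ?n dvd p" "\<not> [:-a, 1:] ^ Suc ?n dvd p"
      using that order by (blast, blast)
    have q: "[:-a, 1:] ^ Suc ?n dvd q" using that order_divides[of a "Suc ?n" q] by auto
    have q': "[:-a, 1:] ^ ?n dvd q" using that order_divides[of a "?n" q] by auto
    have "\<not> [:-a, 1:] ^ Suc ?n dvd p - q" using p(2) q by (metis dvd_diff_commute dvd_diff_right_iff dvd_diffD1)
    moreover have "[:-a, 1:] ^ ?n dvd p - q" using p(1) q' by simp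
    ultimately show ?thesis by (metis dvd_0_right order_unique_lemma)
  qed
  show ?thesis
  proof (cases "order a p < order a q")
    case True then show ?thesis using *[of p q] assms by simp
  next
    case False
    then have "q - p \<noteq> 0 \<and> order a (q - p) = order a q" using *[of q p] assms by simp
    then have "p - q \<noteq> 0 \<and> order a (- (q - p)) = order a q" by (subst order_uminus) auto
    then show ?thesis using False assms by simp
  qed
qed

text \<open>Real squares cannot cancel. With \<open>j\<close> the least order among the nonzero
  terms, dividing by the power \<open>2 * j\<close> leaves a sum of squares that do not all vanish
  at \<open>a\<close>. Hence the order is even and the lowest coefficient positive.\<close>

lemma sum_squares_order:
  fixes f :: "'i \<Rightarrow> real poly"
  assumes "finite I" "i0 \<in> I" "f i0 \<noteq> 0"
  obtains j g where "(\<Sum>i\<in>I. f i ^ 2) = [:-a, 1:] ^ (2 * j) * g" "poly g a > 0"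
    "\<And>i. i \<in> I \<Longrightarrow> [:-a, 1:] ^ j dvd f i"
proof -
  let ?J = "{i\<in>I. f i \<noteq> 0}"
  define j where "j = Min (order a ` f ` ?J)"
  have fin: "finite (order a ` f ` ?J)" "order a ` f ` ?J \<noteq> {}" using assms by auto
  have dvd: "[:-a, 1:] ^ j dvd f i" if "i \<in> I" for i
  proof (cases "f i = 0")
    case False
    then have "j \<le> order a (f i)" unfolding j_def using that fin by (intro Min_le) auto
    then show ?thesis by (simp add: order_divides)
  qed simp
  then obtain h where h: "\<And>i. i \<in> I \<Longrightarrow> f i = [:-a, 1:] ^ j * h i" unfolding dvd_def by metis
  have "j \<in> order a ` f ` ?J" using Min_in[OF fin] by (simp add: j_def)
  then obtain k where k: "k \<in> I" "f k \<noteq> 0" "order a (f k) = j" by auto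
  have "poly (h k) a \<noteq> 0"
  proof
    assume "poly (h k) a = 0"
    then have "[:-a, 1:] ^ Suc j dvd f k" 
      unfolding h[OF k(1)] power_Suc2 by (intro mult_dvd_mono) (auto simp: poly_eq_0_iff_dvd)
    then show False using k order_divides[of a "Suc j" "f k"] by simp
  qed
  then have "0 < poly (\<Sum>i\<in>I. h i ^ 2) a"
    using assms k by (auto simp: poly_sum intro!: sum_pos2[of _ k])
  moreover have "(\<Sum>i\<in>I. f i ^ 2) = [:-a, 1:] ^ (2 * j) * (\<Sum>i\<in>I. h i ^ 2)"
    using h by (simp add: sum_distrib_left power_mult_distrib power_mult[symmetric] mult.commute[of 2])
  ultimately show ?thesis using that dvd by blast
qed

locale matching_graph_at = matching_graph E for E :: "'a \<Rightarrow> 'a \<Rightarrow> bool" +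
  fixes \<theta> :: real
begin

abbreviation m :: "'a set \<Rightarrow> nat" where "m V \<equiv> mult \<theta> (graph_on E V)"

abbreviation lin :: "real poly" where "lin \<equiv> [:-\<theta>, 1:]"

text \<open>Being monic, the polynomial is nonzero, which makes its order at \<open>\<theta>\<close>
  meaningful.\<close>

lemma degree_match_poly:
  assumes "finite V"
  shows "degree (\<mu> V) \<le> card V \<and> coeff (\<mu> V) (card V) = 1"
  using assms
proof (induction "card V" arbitrary: V rule: less_induct)
  case less
  show ?case
  proof (cases "V = {}")
    case True then show ?thesis by (simp add: match_poly_empty)
  next
    case False
    then obtain u where u: "u \<in> V" by auto
    have n: "card V = Suc (card (V - {u}))" using u less.prems by (metis card_Suc_Diff1)
    have IH: "degree (\<mu> (V - {u})) \<le> card (V - {u})" "coeff (\<mu> (V - {u})) (card (V - {u})) = 1"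
      using less.hyps[of "V - {u}"] n less.prems by auto
    have c: "degree (\<mu> (V - {u, c})) < card (V - {u})" if "c \<in> V" "E u c" for c
    proof -
      have "c \<noteq> u" using that irrefl by auto
      then have "V - {u, c} \<subset> V - {u}" using that by auto
      then have "card (V - {u, c}) < card (V - {u})" using less.prems by (intro psubset_card_mono) auto
      then show ?thesis using less.hyps[of "V - {u, c}"] n less.prems by auto
    qed
    let ?S = "\<Sum>c | c \<in> V \<and> E u c. \<mu> (V - {u, c})"
    have dS: "degree ?S \<le> card (V - {u})"
      using c less_imp_le by (intro degree_sum_le) (auto simp: less.prems)
    have cS: "coeff ?S (card V) = 0" using dS n by (intro coeff_eq_0) auto
    have rec: "\<mu> V = pCons 0 (\<mu> (V - {u})) - ?S"
      using match_poly_rec[OF less.prems u] by simp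
    have "degree (pCons 0 (\<mu> (V - {u}))) \<le> card V" using IH n by (metis degree_pCons_le le_trans Suc_le_mono)
    then have "degree (\<mu> V) \<le> card V" unfolding rec using dS n by (intro degree_diff_le) auto
    moreover have "coeff (\<mu> V) (card V) = 1" unfolding rec using cS IH n by simp
    ultimately show ?thesis by simp
  qed
qed

lemma match_poly_nonzero: "finite V \<Longrightarrow> \<mu> V \<noteq> 0"
  using degree_match_poly[of V] by auto

lemma power_dvd_iff: "finite V \<Longrightarrow> lin ^ n dvd \<mu> V \<longleftrightarrow> n \<le> m V"
  using order_divides[of \<theta> n "\<mu> V"] match_poly_nonzero[of V] by (simp add: mult_def)

lemma order_mult_match_poly:
  "finite V \<Longrightarrow> finite W \<Longrightarrow> order \<theta> (\<mu> V * \<mu> W) = m V + m W"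
  using match_poly_nonzero by (simp add: mult_def order_mult)

lemma power_dvd_mult: "finite V \<Longrightarrow> finite W \<Longrightarrow> n \<le> m V + m W \<Longrightarrow> lin ^ n dvd \<mu> V * \<mu> W"
  by (simp add: order_divides order_mult_match_poly)

lemma match_poly_factor:
  assumes "finite V"
  obtains p where "\<mu> V = lin ^ m V * p" "poly p \<theta> \<noteq> 0"
proof -
  obtain p where p: "\<mu> V = lin ^ m V * p" "\<not> lin dvd p"
    using order_decomp[OF match_poly_nonzero[OF assms], of \<theta>] unfolding mult_def by blast
  then show ?thesis using that poly_eq_0_iff_dvd by blast
qed

text \<open>Unequal orders cannot cancel, so the minimum is the order of the difference in the
  two-point identity, which is even because the difference is a sum of squares.\<close>

lemma two_point_parity:
  assumes V: "finite V" "x \<in> V" "y \<in> V" "x \<noteq> y"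
    and ne: "m (V - {x}) + m (V - {y}) \<noteq> m V + m (V - {x, y})"
  shows "even (min (m (V - {x}) + m (V - {y})) (m V + m (V - {x, y})))"
proof -
  let ?G = "\<mu> (V - {x}) * \<mu> (V - {y}) - \<mu> V * \<mu> (V - {x, y})"
  have G: "?G \<noteq> 0" "order \<theta> ?G = min (m (V - {x}) + m (V - {y})) (m V + m (V - {x, y}))"
    using order_diff_less[of "\<mu> (V - {x}) * \<mu> (V - {y})" "\<mu> V * \<mu> (V - {x, y})" \<theta>] V(1) ne
    by (auto simp: order_mult_match_poly match_poly_nonzero)
  have id: "?G = (\<Sum>p\<in>paths V x y. \<mu> (V - set p) ^ 2)" using two_point_identity[OF V] .
  then obtain p where p: "p \<in> paths V x y" using G by fastforce
  obtain j g where jg: "?G = lin ^ (2 * j) * g" "poly g \<theta> > 0"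
    using sum_squares_order[OF finite_paths p, where f = "\<lambda>p. \<mu> (V - set p)" and a = \<theta>] V
    unfolding id by (metis finite_Diff match_poly_nonzero)
  have "order \<theta> ?G = 2 * j" unfolding jg(1)
  proof (subst order_mult)
    show "lin ^ (2 * j) * g \<noteq> 0" using jg by auto
    have "order \<theta> g = 0" using jg(2) by (intro order_0I) auto
    then show "order \<theta> (lin ^ (2 * j)) + order \<theta> g = 2 * j" by (simp add: order_power_n_n)
  qed
  then show ?thesis using G by simp
qed

text \<open>The order of a sum of squares is twice the least order of its terms, so divisibility of
  the left-hand side of the two-point identity passes to every single path.\<close>

lemma path_mult_bound:
  assumes V: "finite V" "x \<in> V" "y \<in> V" "x \<noteq> y"
    and le: "n \<le> m (V - {x}) + m (V - {y})" "n \<le> m V + m (V - {x, y})"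
    and p: "p \<in> paths V x y"
  shows "n \<le> 2 * m (V - set p)"
proof -
  let ?G = "\<mu> (V - {x}) * \<mu> (V - {y}) - \<mu> V * \<mu> (V - {x, y})"
  have id: "?G = (\<Sum>p\<in>paths V x y. \<mu> (V - set p) ^ 2)" using two_point_identity[OF V] .
  obtain j g where jg: "?G = lin ^ (2 * j) * g" "poly g \<theta> > 0"
      "\<And>p. p \<in> paths V x y \<Longrightarrow> lin ^ j dvd \<mu> (V - set p)"
    using sum_squares_order[OF finite_paths p, where f = "\<lambda>p. \<mu> (V - set p)" and a = \<theta>] V
    unfolding id by (metis finite_Diff match_poly_nonzero)
  have G0: "?G \<noteq> 0" using jg by auto
  have g0: "order \<theta> g = 0" using jg(2) by (intro order_0I) auto
  have "order \<theta> ?G = order \<theta> (lin ^ (2 * j)) + order \<theta> g"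
    using G0 unfolding jg(1) by (rule order_mult)
  then have "order \<theta> ?G = 2 * j" using g0 by (simp add: order_power_n_n)
  moreover have "lin ^ n dvd ?G" using le V(1) by (intro dvd_diff power_dvd_mult) auto
  ultimately have "n \<le> 2 * j" using G0 order_divides[of \<theta> n ?G] by simp
  moreover have "j \<le> m (V - set p)" using jg(3)[OF p] V(1) power_dvd_iff by simp
  ultimately show ?thesis by simp
qed

section \<open>Derivative, Wronskian and interlacing\<close>

lemma pderiv_match_poly:
  assumes "finite V"
  shows "pderiv (\<mu> V) = (\<Sum>u\<in>V. \<mu> (V - {u}))"
  using assms
proof (induction "card V" arbitrary: V rule: less_induct)
  case less
  note V = \<open>finite V\<close>
  show ?case
  proof (cases "V = {}")
    case True then show ?thesis by (simp add: match_poly_empty)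
  next
    case False
    then obtain u where u: "u \<in> V" by auto
    have IH: "pderiv (\<mu> (V - X)) = (\<Sum>w\<in>V - X. \<mu> (V - X - {w}))" if "u \<in> X" for X
    proof (rule less.hyps)
      have "V - X \<subset> V" using u that by auto
      then show "card (V - X) < card V" using V by (rule psubset_card_mono[rotated])
    qed (use V in simp)
    have IH1: "pderiv (\<mu> (V - {u})) = (\<Sum>w\<in>V - {u}. \<mu> (V - {u, w}))"
      using IH[of "{u}"] by (simp add: Diff_Diff_Un insert_commute)
    have IH2: "pderiv (\<mu> (V - {u, c})) = (\<Sum>w\<in>V - {u, c}. \<mu> (V - {u, c, w}))" for c
      using IH[of "{u, c}"] by (simp add: Diff_Diff_Un insert_commute)
    let ?N = "{c. c \<in> V \<and> E u c}"
    let ?s = "\<lambda>w c. if w = c then 0 else \<mu> (V - {u, c, w})"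
    have "pderiv (\<mu> V) = \<mu> (V - {u}) + [:0, 1:] * (\<Sum>w\<in>V - {u}. \<mu> (V - {u, w}))
        - (\<Sum>c\<in>?N. \<Sum>w\<in>V - {u, c}. \<mu> (V - {u, c, w}))"
      by (subst match_poly_rec[OF V u])
        (simp add: pderiv_diff pderiv_mult pderiv_pCons pderiv_sum IH1 IH2 del: mult_pCons_left)
    also have "(\<Sum>c\<in>?N. \<Sum>w\<in>V - {u, c}. \<mu> (V - {u, c, w})) = (\<Sum>c\<in>?N. \<Sum>w\<in>V - {u}. ?s w c)"
      using V by (intro sum.cong[OF refl] sum.mono_neutral_cong_left) auto
    also have "\<dots> = (\<Sum>w\<in>V - {u}. \<Sum>c\<in>?N. ?s w c)" by (rule sum.swap)
    finally have l: "pderiv (\<mu> V) = \<mu> (V - {u}) +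
        (\<Sum>w\<in>V - {u}. [:0, 1:] * \<mu> (V - {u, w}) - (\<Sum>c\<in>?N. ?s w c))"
      by (simp only: sum_subtractf sum_distrib_left algebra_simps)
    \<comment> \<open>After the double sum has been swapped, the bracket belonging to
      \<open>w\<close> is the recursion for \<open>V - {w}\<close> at \<open>u\<close>.\<close>
    have "\<mu> (V - {w}) = [:0, 1:] * \<mu> (V - {u, w}) - (\<Sum>c\<in>?N. ?s w c)" if w: "w \<in> V - {u}" for w
    proof -
      have "\<mu> (V - {w}) = [:0, 1:] * \<mu> (V - {w} - {u}) - (\<Sum>c | c \<in> V - {w} \<and> E u c. \<mu> (V - {w} - {u, c}))"
        using V u w by (intro match_poly_rec) auto
      also have "(\<Sum>c | c \<in> V - {w} \<and> E u c. \<mu> (V - {w} - {u, c})) = (\<Sum>c\<in>?N. ?s w c)"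
        using V by (intro sum.mono_neutral_cong_left) (auto simp: Diff_Diff_Un insert_commute)
      finally show ?thesis by (simp add: Diff_Diff_Un insert_commute)
    qed
    then show ?thesis unfolding l using V u by (simp add: sum.remove[of V u])
  qed
qed

text \<open>This is the sum of the two-point identities for \<open>u\<close> over all other
  vertices; the one-vertex path supplies the remaining term
  \<open>\<mu> (V - {u}) ^ 2\<close>.\<close>

lemma wronskian_match_poly:
  assumes V: "finite V" "u \<in> V"
  shows "pderiv (\<mu> V) * \<mu> (V - {u}) - \<mu> V * pderiv (\<mu> (V - {u})) =
    (\<Sum>p\<in>(\<Union>w\<in>V. paths V u w). \<mu> (V - set p) ^ 2)"
proof -
  have "(\<Sum>p\<in>(\<Union>w\<in>V. paths V u w). \<mu> (V - set p) ^ 2) = (\<Sum>w\<in>V. \<Sum>p\<in>paths V u w. \<mu> (V - set p) ^ 2)"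
    using V finite_paths by (intro sum.UNION_disjoint) (auto simp: paths_def)
  also have "\<dots> = \<mu> (V - {u}) ^ 2 + (\<Sum>w\<in>V - {u}. \<Sum>p\<in>paths V u w. \<mu> (V - set p) ^ 2)"
    using V by (simp add: sum.remove[of V u] paths_same)
  also have "(\<Sum>w\<in>V - {u}. \<Sum>p\<in>paths V u w. \<mu> (V - set p) ^ 2) =
      (\<Sum>w\<in>V - {u}. \<mu> (V - {u}) * \<mu> (V - {w}) - \<mu> V * \<mu> (V - {u, w}))"
    using V by (intro sum.cong[OF refl] two_point_identity[symmetric]) auto
  also have "\<mu> (V - {u}) ^ 2 + \<dots> =
      (\<Sum>w\<in>V. \<mu> (V - {w})) * \<mu> (V - {u}) - \<mu> V * (\<Sum>w\<in>V - {u}. \<mu> (V - {u} - {w}))"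
    using V by (simp add: sum.remove[of V u] sum_subtractf sum_distrib_left Diff_Diff_Un insert_commute
        power2_eq_square algebra_simps)
  finally show ?thesis using V by (simp add: pderiv_match_poly)
qed

text \<open>The extra factor \<open>lin\<close> avoids the exponent \<open>a - 1\<close>, so that
  \<open>a = 0\<close> is covered by the same formula.\<close>

lemma lin_mult_pderiv: "lin * pderiv (lin ^ a * p) = of_nat a * (lin ^ a * p) + lin * lin ^ a * pderiv p"
proof (cases a)
  case (Suc b)
  have "pderiv (lin ^ Suc b) = of_nat (Suc b) * lin ^ b"
    by (simp add: pderiv_power_Suc pderiv_pCons of_nat_poly del: power_Suc of_nat_Suc)
  then have "pderiv (lin ^ Suc b * p) = of_nat (Suc b) * lin ^ b * p + lin ^ Suc b * pderiv p"
    by (simp only: pderiv_mult mult.commute add.commute)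
  then show ?thesis unfolding Suc by (simp only: distrib_left power_Suc mult_ac)
qed (simp add: pderiv_mult)

lemma lin_power_cancel:
  assumes "lin ^ i * p = lin ^ j * q" "poly p \<theta> \<noteq> 0" "poly q \<theta> \<noteq> 0"
  shows "i = j \<and> p = q"
proof -
  have *: "i = order \<theta> (lin ^ i * p)" if "poly p \<theta> \<noteq> 0" for i p
  proof -
    have "lin ^ i * p \<noteq> 0" using that by auto
    then have "order \<theta> (lin ^ i * p) = i + order \<theta> p" by (simp add: order_mult order_power_n_n)
    then show ?thesis using that order_0I by simp
  qed
  have "i = j" using *[of p i] *[of q j] assms by simp
  then show ?thesis using assms(1) by simp
qed

text \<open>Let \<open>a\<close> and \<open>b\<close> be the two multiplicities. The Wronskian times
  \<open>lin\<close> is \<open>lin ^ (a + b)\<close> times a polynomial with value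
  \<open>(a - b) * poly (p * q) \<theta>\<close> at \<open>\<theta>\<close>. As a sum of squares,
  the Wronskian has even order \<open>2 * j\<close> and positive lowest coefficient. Thus
  \<open>a + b = 2 * j + 1\<close>, and \<open>a - b\<close> has the sign of
  \<open>poly (p * q) \<theta>\<close>.\<close>

lemma mult_del_neq:
  assumes V: "finite V" "u \<in> V" and ne: "m V \<noteq> m (V - {u})"
    and p: "\<mu> V = lin ^ m V * p" "poly p \<theta> \<noteq> 0" and q: "\<mu> (V - {u}) = lin ^ m (V - {u}) * q" "poly q \<theta> \<noteq> 0"
  shows "(m V = m (V - {u}) + 1 \<and> poly (p * q) \<theta> > 0) \<or> m (V - {u}) = m V + 1"
proof -
  let ?a = "m V" and ?b = "m (V - {u})"
  let ?P = "\<Union>w\<in>V. paths V u w"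
  let ?W = "pderiv (\<mu> V) * \<mu> (V - {u}) - \<mu> V * pderiv (\<mu> (V - {u}))"
  have u1: "[u] \<in> ?P" using V by (auto simp: paths_def)
  have fin: "finite ?P" using V finite_paths by auto
  obtain j g where W: "?W = lin ^ (2 * j) * g" and g: "poly g \<theta> > 0"
    and dvd: "\<And>p. p \<in> ?P \<Longrightarrow> lin ^ j dvd \<mu> (V - set p)"
    using sum_squares_order[OF fin u1, where f = "\<lambda>p. \<mu> (V - set p)" and a = \<theta>] V
    unfolding wronskian_match_poly[OF V] by (metis finite_Diff match_poly_nonzero)
  \<comment> \<open>The paths with one vertex and with one edge are among the summands, so
    \<open>j\<close> is at most these multiplicities; this rules out gaps larger than one.\<close>
  have jb: "j \<le> ?b" using dvd[OF u1] V by (simp add: power_dvd_iff)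
  have jc: "j \<le> m (V - {u, c})" if "c \<in> V" "E u c" for c
  proof -
    have "[u, c] \<in> ?P" using that V irrefl by (auto simp: paths_def)
    then show ?thesis using dvd[of "[u, c]"] V by (simp add: power_dvd_iff)
  qed
  let ?h = "(of_nat ?a - of_nat ?b) * (p * q) + lin * (pderiv p * q - p * pderiv q)"
  have expand: "(s * (A * p) + L * A * p') * (B * q) - (A * p) * (t * (B * q) + L * B * q') =
      (A * B) * ((s - t) * (p * q) + L * (p' * q - p * q'))" for s t A B L p q p' q' :: "real poly"
    by (simp add: algebra_simps)
  have 1: "lin * pderiv (\<mu> V) = of_nat ?a * \<mu> V + lin * lin ^ ?a * pderiv p"
    using lin_mult_pderiv[of ?a p] p(1) by metis
  have 2: "lin * pderiv (\<mu> (V - {u})) = of_nat ?b * \<mu> (V - {u}) + lin * lin ^ ?b * pderiv q"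
    using lin_mult_pderiv[of ?b q] q(1) by metis
  have "lin ^ Suc (2 * j) * g = lin * ?W" using W by (simp only: power_Suc mult.assoc)
  also have "\<dots> = (lin * pderiv (\<mu> V)) * \<mu> (V - {u}) - \<mu> V * (lin * pderiv (\<mu> (V - {u})))"
    by (simp only: algebra_simps)
  also have "\<dots> = (of_nat ?a * (lin ^ ?a * p) + lin * lin ^ ?a * pderiv p) * (lin ^ ?b * q)
      - (lin ^ ?a * p) * (of_nat ?b * (lin ^ ?b * q) + lin * lin ^ ?b * pderiv q)"
    unfolding 1 2 p(1)[symmetric] q(1)[symmetric] ..
  also have "\<dots> = lin ^ (?a + ?b) * ?h"
    unfolding expand power_add ..
  finally have eq: "lin ^ Suc (2 * j) * g = lin ^ (?a + ?b) * ?h" .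
  have h: "poly ?h \<theta> = (real ?a - real ?b) * poly (p * q) \<theta>" by simp
  then have "poly ?h \<theta> \<noteq> 0" using ne p(2) q(2) by simp
  then have ab: "Suc (2 * j) = ?a + ?b" "g = ?h" using lin_power_cancel[OF eq] g by auto
  have pos: "(real ?a - real ?b) * poly (p * q) \<theta> > 0" using ab(2) g h by simp
  show ?thesis
  proof (cases "?b < ?a")
    case True
    then show ?thesis using pos jb ab(1) by (auto simp: zero_less_mult_iff)
  next
    case False
    \<comment> \<open>Otherwise \<open>j\<close> exceeds \<open>?a\<close>, and every term of the
      recursion at \<open>u\<close> is divisible by \<open>lin ^ Suc ?a\<close>, hence so is
      \<open>\<mu> V\<close>.\<close>
    have "\<not> ?a + 2 \<le> ?b"
    proof
      assume a: "?a + 2 \<le> ?b"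
      then have j: "Suc ?a \<le> j" using ab(1) by simp
      have "lin ^ Suc ?a dvd [:0,1:] * \<mu> (V - {u}) - (\<Sum>c | c \<in> V \<and> E u c. \<mu> (V - {u, c}))"
      proof (intro dvd_diff dvd_mult dvd_sum)
        show "lin ^ Suc ?a dvd \<mu> (V - {u})" using a V(1) power_dvd_iff[of "V - {u}" "Suc ?a"] by simp
        fix c assume "c \<in> {c. c \<in> V \<and> E u c}"
        then show "lin ^ Suc ?a dvd \<mu> (V - {u, c})"
          using jc[of c] j V(1) power_dvd_iff[of "V - {u, c}" "Suc ?a"] by simp
      qed
      then show False using match_poly_rec[OF V] power_dvd_iff[OF V(1), of "Suc ?a"] by simp
    qed
    then show ?thesis using ne False by linarith
  qed
qed

lemma interlacing:
  assumes "finite V" "u \<in> V"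
  shows "m V \<le> m (V - {u}) + 1" "m (V - {u}) \<le> m V + 1"
proof -
  obtain p where "\<mu> V = lin ^ m V * p" "poly p \<theta> \<noteq> 0" using match_poly_factor assms(1) by blast
  moreover obtain q where "\<mu> (V - {u}) = lin ^ m (V - {u}) * q" "poly q \<theta> \<noteq> 0"
    using match_poly_factor[of "V - {u}"] assms(1) by blast
  ultimately have "m V = m (V - {u}) \<or> m V = m (V - {u}) + 1 \<or> m (V - {u}) = m V + 1"
    using mult_del_neq[OF assms] by blast
  then show "m V \<le> m (V - {u}) + 1" "m (V - {u}) \<le> m V + 1" by auto
qed

text \<open>If deleting \<open>u\<close> lowers the multiplicity, the factor \<open>lin\<close>
  makes the order even and the lowest coefficient is positive by \<open>mult_del_neq\<close>.
  Otherwise the product alone is divisible by \<open>lin ^ (2 * j)\<close>, and \<open>lin\<close>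
  makes the cofactor vanish at \<open>\<theta>\<close>.\<close>

lemma adjacent_product_nonneg:
  assumes V: "finite V" "u \<in> V" and j: "j \<le> m V"
  obtains r where "lin * (\<mu> V * \<mu> (V - {u})) = lin ^ (2 * j) * r" "poly r \<theta> \<ge> 0"
proof -
  obtain p where p: "\<mu> V = lin ^ m V * p" "poly p \<theta> \<noteq> 0" using match_poly_factor V(1) by blast
  obtain q where q: "\<mu> (V - {u}) = lin ^ m (V - {u}) * q" "poly q \<theta> \<noteq> 0"
    using match_poly_factor[of "V - {u}"] V(1) by blast
  show ?thesis
  proof (cases "m V = m (V - {u}) + 1")
    case True
    then have pos: "poly (p * q) \<theta> > 0" using mult_del_neq[OF V _ p q] by auto
    have "lin * (\<mu> V * \<mu> (V - {u})) = lin * ((lin ^ m V * p) * (lin ^ m (V - {u}) * q))"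
      using p(1) q(1) by (rule arg_cong2[of _ _ _ _ "\<lambda>a b. lin * (a * b)"])
    also have "\<dots> = lin ^ (m (V - {u}) + 1) * lin ^ m V * (p * q)"
      by (simp only: power_add power_one_right mult_ac)
    also have "\<dots> = lin ^ (2 * j + 2 * (m V - j)) * (p * q)"
      using True j by (simp only: power_add[symmetric]) (simp add: mult_2)
    finally have "lin * (\<mu> V * \<mu> (V - {u})) = lin ^ (2 * j) * (lin ^ (2 * (m V - j)) * (p * q))"
      by (simp only: power_add mult.assoc)
    moreover have "poly (lin ^ (2 * (m V - j)) * (p * q)) \<theta> \<ge> 0"
      using pos by (simp add: zero_le_even_power)
    ultimately show ?thesis using that by blast
  next
    case False
    then have "2 * j \<le> m V + m (V - {u})" using interlacing[OF V] j by simp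
    then obtain s where "\<mu> V * \<mu> (V - {u}) = lin ^ (2 * j) * s"
      using power_dvd_mult[of V "V - {u}" "2 * j"] V(1) by (auto elim: dvdE)
    then have "lin * (\<mu> V * \<mu> (V - {u})) = lin ^ (2 * j) * (lin * s)" by (simp only: mult_ac)
    then show ?thesis using that[of "lin * s"] by simp
  qed
qed

text \<open>The two inequalities let \<open>path_mult_bound\<close> give
  \<open>j \<le> m (V - set p)\<close> for each path; then \<open>adjacent_product_nonneg\<close>
  treats each summand, and the cofactors add up.\<close>

lemma path_sum_nonneg:
  assumes V: "finite V" "x \<in> V" "y \<in> V" "x \<noteq> y" "z \<in> V"
    and le: "2 * j \<le> m (V - {x}) + m (V - {y})" "2 * j \<le> m V + m (V - {x, y})"
  obtains r where "lin * path_sum V x y z = lin ^ (2 * j) * r" "poly r \<theta> \<ge> 0"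
proof -
  have "\<exists>r. lin * (\<mu> (V - set p) * \<mu> (V - insert z (set p))) = lin ^ (2 * j) * r \<and> poly r \<theta> \<ge> 0"
    if p: "p \<in> paths (V - {z}) x y" for p
  proof -
    have pV: "p \<in> paths V x y" and z: "z \<in> V - set p" using p V by (auto simp: paths_def)
    have "j \<le> m (V - set p)" using path_mult_bound[OF V(1-4) le pV] by simp
    moreover have "V - insert z (set p) = V - set p - {z}" by auto
    ultimately show ?thesis using adjacent_product_nonneg[of "V - set p" z j] V(1) z by (metis finite_Diff)
  qed
  then obtain r where r: "\<And>p. p \<in> paths (V - {z}) x y \<Longrightarrow>
      lin * (\<mu> (V - set p) * \<mu> (V - insert z (set p))) = lin ^ (2 * j) * r p \<and> poly (r p) \<theta> \<ge> 0"
    by metis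
  show ?thesis
  proof (rule that)
    show "lin * path_sum V x y z = lin ^ (2 * j) * (\<Sum>p\<in>paths (V - {z}) x y. r p)"
      unfolding path_sum_def sum_distrib_left using r by (intro sum.cong) auto
    show "poly (\<Sum>p\<in>paths (V - {z}) x y. r p) \<theta> \<ge> 0"
      using r by (auto simp: poly_sum intro: sum_nonneg)
  qed
qed

text \<open>The divisibility makes the coefficients of \<open>(x - \<theta>) ^ (2 * j - 1)\<close> in all path sums nonnegative;
  those of the three-point identities at \<open>y\<close> and at \<open>z\<close> vanish, hence so do all of them.\<close>

lemma three_point_bound:
  assumes V: "finite V" "x \<in> V" "y \<in> V" "z \<in> V" "x \<noteq> y" "x \<noteq> z" "y \<noteq> z"
    and xy: "2 * j \<le> m (V - {x}) + m (V - {y})" "2 * j \<le> m V + m (V - {x, y})"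
    and xz: "2 * j \<le> m (V - {x}) + m (V - {z})" "2 * j \<le> m V + m (V - {x, z})"
    and yz: "2 * j \<le> m (V - {y}) + m (V - {z})" "2 * j \<le> m V + m (V - {y, z})"
    and xyz: "2 * j \<le> m V + m (V - {x, y, z})"
    and y_xz: "2 * j \<le> m (V - {y}) + m (V - {x, z})"
    and z_xy: "2 * j \<le> m (V - {z}) + m (V - {x, y})"
  shows "2 * j \<le> m (V - {x}) + m (V - {y, z})"
proof -
  obtain a where a: "lin * path_sum V x y z = lin ^ (2 * j) * a" "poly a \<theta> \<ge> 0"
    using path_sum_nonneg[of V x y z j] V xy by blast
  obtain b where b: "lin * path_sum V x z y = lin ^ (2 * j) * b" "poly b \<theta> \<ge> 0"
    using path_sum_nonneg[of V x z y j] V xz by blast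
  obtain c where c: "lin * path_sum V y z x = lin ^ (2 * j) * c" "poly c \<theta> \<ge> 0"
    using path_sum_nonneg[of V y z x j] V yz by blast
  have l0: "lin ^ (2 * j) \<noteq> 0" by simp
  have *: "poly (r + s) \<theta> = 0"
    if P: "lin * P = lin ^ (2 * j) * r" and Q: "lin * Q = lin ^ (2 * j) * s" and PQ: "lin ^ (2 * j) dvd P + Q" for P Q r s
  proof -
    obtain t where t: "P + Q = lin ^ (2 * j) * t" using PQ by (auto elim: dvdE)
    have "lin ^ (2 * j) * (r + s) = lin * (P + Q)" using P Q by (simp only: distrib_left)
    also have "\<dots> = lin ^ (2 * j) * (lin * t)" unfolding t by (simp only: mult_ac)
    finally have "r + s = lin * t" using l0 by (simp only: mult_cancel_left) simp
    then show ?thesis by simp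
  qed
  have "lin ^ (2 * j) dvd path_sum V y x z + path_sum V y z x"
    using three_point_identity[of V y x z, symmetric] V y_xz xyz
    by (simp add: insert_commute dvd_diff power_dvd_mult)
  then have "poly (a + c) \<theta> = 0" using *[OF a(1) c(1)] by (simp add: path_sum_commute)
  moreover have "lin ^ (2 * j) dvd path_sum V z x y + path_sum V z y x"
    using three_point_identity[of V z x y, symmetric] V z_xy xyz
    by (simp add: insert_commute dvd_diff power_dvd_mult)
  then have "poly (b + c) \<theta> = 0" using *[OF b(1) c(1)] by (simp add: path_sum_commute)
  ultimately have "poly (a + b) \<theta> = 0" using a(2) b(2) c(2) by simp
  \<comment> \<open>The root at \<open>\<theta>\<close> makes up for the factor \<open>lin\<close>
    by which the path sums were multiplied.\<close>
  then obtain t where t: "a + b = lin * t" unfolding poly_eq_0_iff_dvd by (rule dvdE)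
  have "lin * (path_sum V x y z + path_sum V x z y) = lin ^ (2 * j) * (a + b)"
    using a(1) b(1) by (simp only: distrib_left)
  also have "\<dots> = lin * (lin ^ (2 * j) * t)" unfolding t by (simp only: mult_ac)
  finally have "path_sum V x y z + path_sum V x z y = lin ^ (2 * j) * t" by (simp only: mult_cancel_left) simp
  then have "lin ^ (2 * j) dvd \<mu> (V - {x}) * \<mu> (V - {y, z}) - \<mu> V * \<mu> (V - {x, y, z})"
    using three_point_identity[OF V] by simp
  moreover have "lin ^ (2 * j) dvd \<mu> V * \<mu> (V - {x, y, z})" using V xyz by (intro power_dvd_mult) auto
  ultimately have "lin ^ (2 * j) dvd \<mu> (V - {x}) * \<mu> (V - {y, z})"
    by (metis diff_add_cancel dvd_add)
  then show ?thesis using V(1) match_poly_nonzero by (simp add: order_divides order_mult_match_poly)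
qed

section \<open>Essential and special vertices\<close>

text \<open>The additive form keeps the arithmetic in the natural numbers.\<close>

definition ess :: "'a set \<Rightarrow> 'a \<Rightarrow> bool" where
  "ess V u \<longleftrightarrow> u \<in> V \<and> m V = m (V - {u}) + 1"

lemma ess_in: "ess V u \<Longrightarrow> u \<in> V"
  by (simp add: ess_def)

lemma essential_iff_ess: "essential \<theta> (graph_on E V) u \<longleftrightarrow> ess V u"
  by (auto simp: essential_def ess_def del_graph_on)

text \<open>Interlacing leaves one bad pattern, \<open>m (V - {a}) = m (V - {a, w}) = m V\<close>.
  With \<open>k = m (V - {w})\<close>, the two products in the two-point identity then have orders
  \<open>2 * k + 1\<close> and \<open>2 * k + 2\<close>, against parity.\<close>

lemma ess_del:
  assumes V: "finite V" and w: "ess V w" and a: "a \<in> V" "\<not> ess V a"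
  shows "ess (V - {a}) w"
proof -
  have aw: "a \<noteq> w" "w \<in> V" and mw: "m V = m (V - {w}) + 1" using w a by (auto simp: ess_def)
  have e1: "V - {a} - {w} = V - {a, w}" and e2: "V - {w} - {a} = V - {a, w}" by auto
  have i1: "m V \<le> m (V - {a}) + 1" "m (V - {a}) \<le> m V + 1" using interlacing[OF V a(1)] by auto
  have i2: "m (V - {a}) \<le> m (V - {a, w}) + 1" "m (V - {a, w}) \<le> m (V - {a}) + 1"
    using interlacing[of "V - {a}" w] V aw unfolding e1 by auto
  have i3: "m (V - {w}) \<le> m (V - {a, w}) + 1" "m (V - {a, w}) \<le> m (V - {w}) + 1"
    using interlacing[of "V - {w}" a] V aw a unfolding e2 by auto
  have na: "m V \<noteq> m (V - {a}) + 1" using a by (simp add: ess_def)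
  have "m (V - {a}) = m (V - {a, w}) + 1"
  proof (rule ccontr)
    assume "m (V - {a}) \<noteq> m (V - {a, w}) + 1"
    then have "m (V - {a}) = m V" "m (V - {a, w}) = m V" using i1 i2 i3 na mw by linarith+
    then show False using two_point_parity[OF V a(1) aw(2,1)] mw by simp
  qed
  then show ?thesis using aw e1 by (simp add: ess_def)
qed

text \<open>Without such a neighbour, every term of the recursion at \<open>a\<close> is divisible
  by \<open>lin ^ m (V - {a})\<close>. Conversely, if \<open>m V\<close> exceeded
  \<open>m (V - {a, w})\<close>, the path bound would fail for the edge from \<open>a\<close> to
  \<open>w\<close>.\<close>

lemma positive_iff:
  assumes V: "finite V" and a: "a \<in> V"
  shows "m (V - {a}) = m V + 1 \<longleftrightarrow> (\<exists>c\<in>V. E a c \<and> ess (V - {a}) c)"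
proof
  assume pos: "m (V - {a}) = m V + 1"
  show "\<exists>c\<in>V. E a c \<and> ess (V - {a}) c"
  proof (rule ccontr)
    assume no: "\<not> (\<exists>c\<in>V. E a c \<and> ess (V - {a}) c)"
    have le: "m (V - {a}) \<le> m (V - {a, c})" if c: "c \<in> V" "E a c" for c
    proof -
      have ca: "c \<in> V - {a}" using c irrefl by auto
      have "V - {a} - {c} = V - {a, c}" by auto
      moreover have "m (V - {a}) \<noteq> m (V - {a} - {c}) + 1" using no c ca by (auto simp: ess_def)
      ultimately show ?thesis using interlacing(1)[of "V - {a}" c] V ca by simp
    qed
    have "lin ^ m (V - {a}) dvd [:0,1:] * \<mu> (V - {a}) - (\<Sum>c | c \<in> V \<and> E a c. \<mu> (V - {a, c}))"
      using V le by (intro dvd_diff dvd_mult dvd_sum) (auto simp: power_dvd_iff)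
    then show False using match_poly_rec[OF V a] power_dvd_iff[OF V, of "m (V - {a})"] pos by simp
  qed
next
  assume "\<exists>c\<in>V. E a c \<and> ess (V - {a}) c"
  then obtain w where w: "w \<in> V" "E a w" "ess (V - {a}) w" by blast
  have aw: "a \<noteq> w" using w irrefl by auto
  have e1: "V - {a} - {w} = V - {a, w}" by auto
  have k: "m (V - {a}) = m (V - {a, w}) + 1" using w e1 by (simp add: ess_def)
  have "m V \<le> m (V - {a, w})"
  proof (rule ccontr)
    assume c: "\<not> m V \<le> m (V - {a, w})"
    have "[a, w] \<in> paths V a w" using a w aw by (auto simp: paths_def)
    moreover have "2 * m (V - {a, w}) + 1 \<le> m (V - {a}) + m (V - {w})"
      using c k interlacing(1)[OF V w(1)] by linarith
    ultimately have "2 * m (V - {a, w}) + 1 \<le> 2 * m (V - set [a, w])"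
      using c by (intro path_mult_bound[OF V a w(1) aw]) auto
    then show False by simp
  qed
  then show "m (V - {a}) = m V + 1" using k interlacing(2)[OF V a] by simp
qed

text \<open>The order of the derivative is one less than that of \<open>\<mu> V\<close>, but the
  derivative is the sum of all \<open>\<mu> (V - {u})\<close>; so some summand has smaller order
  than \<open>\<mu> V\<close>.\<close>

lemma ex_ess:
  assumes V: "finite V" and "m V \<noteq> 0"
  shows "\<exists>u. ess V u"
proof (rule ccontr)
  assume no: "\<not> (\<exists>u. ess V u)"
  have le: "m V \<le> m (V - {u})" if u: "u \<in> V" for u
  proof -
    have "m V \<noteq> m (V - {u}) + 1" using no u by (auto simp: ess_def)
    then show ?thesis using interlacing(1)[OF V u] by simp
  qed
  have dvd: "lin ^ m V dvd pderiv (\<mu> V)"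
    unfolding pderiv_match_poly[OF V] using V le by (intro dvd_sum) (simp add: power_dvd_iff)
  have "degree (\<mu> V) \<noteq> 0"
    using assms order_degree[OF match_poly_nonzero[OF V], of \<theta>] by (simp add: mult_def)
  then have nz: "pderiv (\<mu> V) \<noteq> 0" by (simp add: pderiv_eq_0_iff)
  then have "order \<theta> (\<mu> V) = Suc (order \<theta> (pderiv (\<mu> V)))"
    using assms by (intro order_pderiv) (auto simp: mult_def order_root)
  moreover have "m V \<le> order \<theta> (pderiv (\<mu> V))" using dvd nz by (simp add: order_divides)
  ultimately show False by (simp add: mult_def)
qed

lemma special_positive:
  assumes V: "finite V" and a: "a \<in> V" "\<not> ess V a" and w: "ess V w" "E a w"
  shows "m (V - {a}) = m V + 1"
  using positive_iff[OF V a(1)] ess_del[OF V w(1) a] w by (auto simp: ess_def)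

text \<open>If \<open>z\<close> became essential only after deleting \<open>a\<close>, then
  interlacing and parity would determine the multiplicities for all subsets of
  \<open>{a, w, z}\<close> closely enough to contradict \<open>three_point_bound\<close>.\<close>

lemma ess_del_special:
  assumes V: "finite V" and a: "a \<in> V" "\<not> ess V a" and w: "ess V w" "E a w"
  shows "ess (V - {a}) z \<longleftrightarrow> ess V z"
proof
  assume "ess V z" then show "ess (V - {a}) z" using ess_del[OF V _ a] by blast
next
  assume z: "ess (V - {a}) z"
  show "ess V z"
  proof (rule ccontr)
    assume nz: "\<not> ess V z"
    have zV: "z \<in> V" "z \<noteq> a" and wV: "w \<in> V" using z w by (auto simp: ess_def)
    have zw: "z \<noteq> w" and aw: "a \<noteq> w" using nz a w irrefl by auto
    have e: "V - {a} - {z} = V - {a, z}" "V - {z} - {a} = V - {a, z}" "V - {z} - {w} = V - {z, w}"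
      "V - {w} - {z} = V - {z, w}" "V - {w} - {a} = V - {a, w}" "V - {a} - {w} = V - {a, w}"
      "V - {a, z} - {w} = V - {w, a, z}" "V - {w} - {a, z} = V - {w, a, z}" "V - {z, w} - {a} = V - {w, a, z}"
      by auto
    let ?k = "m (V - {w})"
    have mV: "m V = ?k + 1" using w by (simp add: ess_def)
    have ma: "m (V - {a}) = ?k + 2" using special_positive[OF assms] mV by simp
    have maz: "m (V - {a, z}) = ?k + 1" using z ma e by (simp add: ess_def)
    have maw: "m (V - {a, w}) = ?k + 1" using ess_del[OF V w(1) a] ma e by (simp add: ess_def)
    have wz: "ess (V - {z}) w" using ess_del[OF V w(1) zV(1) nz] .
    \<comment> \<open>Since \<open>z\<close> is not essential,
      \<open>m (V - {z}) \<ge> ?k + 1\<close>, so deleting \<open>a\<close> does not raise it. As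
      \<open>w\<close> is still essential and adjacent to \<open>a\<close>, this forces
      \<open>a\<close> to be essential in \<open>V - {z}\<close>.\<close>
    have anp: "m (V - {z} - {a}) \<noteq> m (V - {z}) + 1"
      using interlacing(1)[OF V zV(1)] nz maz mV zV e by (auto simp: ess_def)
    moreover have "finite (V - {z})" "a \<in> V - {z}" using V a(1) zV by auto
    ultimately have "ess (V - {z}) a" using special_positive[OF _ _ _ wz w(2)] by blast
    then have mz: "m (V - {z}) = ?k + 2" using maz e by (simp add: ess_def)
    have mzw: "m (V - {z, w}) = ?k + 1" using wz mz e by (simp add: ess_def)
    \<comment> \<open>Otherwise the neighbour \<open>w\<close> would make deletion of
      \<open>a\<close> raise the multiplicity of \<open>V - {z}\<close>.\<close>
    have "\<not> ess (V - {z} - {a}) w"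
      using positive_iff[of "V - {z}" a] V a zV anp w(2) wV zw by auto
    then have "m (V - {w, a, z}) \<ge> ?k + 1"
      using interlacing(1)[of "V - {a, z}" w] V wV zw aw maz e by (auto simp: ess_def)
    \<comment> \<open>In \<open>V - {w}\<close> the two orders would be \<open>2 * ?k + 2\<close>
      and \<open>2 * ?k + 1\<close>, with odd minimum.\<close>
    moreover have "m (V - {w, a, z}) \<noteq> ?k + 1"
    proof
      assume eq: "m (V - {w, a, z}) = ?k + 1"
      have "even (min (m (V - {w} - {a}) + m (V - {w} - {z})) (?k + m (V - {w} - {a, z})))"
        by (rule two_point_parity) (use V a(1) zV aw zw eq maw mzw in \<open>simp_all add: e\<close>)
      then show False using eq maw mzw by (simp add: e)
    qed
    ultimately have mwaz: "m (V - {w, a, z}) \<ge> ?k + 2" by simp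
    have "2 * (?k + 1) \<le> ?k + m (V - {a, z})"
      by (rule three_point_bound[OF V wV a(1) zV(1)])
        (use aw zw zV ma mz maw mzw maz mwaz mV in \<open>simp_all add: insert_commute\<close>)
    then show False using maz by simp
  qed
qed

text \<open>Each deletion preserves the essential vertices, so the remaining vertices of
  \<open>B\<close> stay special and can be deleted in turn.\<close>

lemma ess_del_specials:
  assumes V: "finite V" and B: "B \<subseteq> V" "\<And>a. a \<in> B \<Longrightarrow> \<not> ess V a \<and> (\<exists>w. ess V w \<and> E a w)"
  shows "m (V - B) = m V + card B \<and> (\<forall>z. ess (V - B) z \<longleftrightarrow> ess V z)"
proof -
  have "finite B" using V B finite_subset by blast
  then show ?thesis using B
  proof (induction B rule: finite_induct)
    case (insert a B)
    have IH: "m (V - B) = m V + card B" "\<And>z. ess (V - B) z \<longleftrightarrow> ess V z" using insert by auto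
    obtain w where w: "ess V w" "E a w" using insert.prems by auto
    have s: "finite (V - B)" "a \<in> V - B" "\<not> ess (V - B) a" "ess (V - B) w" "E a w"
      using V insert w IH by auto
    have e: "V - insert a B = V - B - {a}" by auto
    show ?case using special_positive[OF s] ess_del_special[OF s] IH insert.hyps unfolding e by simp
  qed simp
qed

section \<open>Gallai's lemma\<close>

lemma linked_trans:
  assumes V: "finite V" and x: "ess V x" and y: "ess V y" and z: "ess V z"
    and d: "x \<noteq> y" "y \<noteq> z" "x \<noteq> z"
    and xy: "m V \<le> m (V - {x, y}) + 1" and yz: "m V \<le> m (V - {y, z}) + 1"
  shows "m V \<le> m (V - {x, z}) + 1"
proof (rule ccontr)
  assume n: "\<not> m V \<le> m (V - {x, z}) + 1"
  have e: "V - {x} - {z} = V - {x, z}" "V - {x} - {y} = V - {x, y}" "V - {z} - {x} = V - {x, z}" "V - {z} - {y} = V - {y, z}"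
      "V - {y} - {x} = V - {x, y}" "V - {y} - {z} = V - {y, z}"
      "V - {x, y} - {z} = V - {x, y, z}" "V - {y, z} - {x} = V - {x, y, z}" "V - {y} - {x, z} = V - {x, y, z}"
    by auto
  have xV: "x \<in> V" and yV: "y \<in> V" and zV: "z \<in> V" using x y z by (auto simp: ess_def)
  let ?k = "m (V - {x, z})"
  have mx: "m V = m (V - {x}) + 1" and my: "m V = m (V - {y}) + 1" and mz: "m V = m (V - {z}) + 1"
    using x y z by (auto simp: ess_def)
  have mV: "m V = ?k + 2" using interlacing(1)[of "V - {x}" z] V zV d mx n e by simp
  \<comment> \<open>In \<open>V - {x}\<close> the vertex \<open>z\<close> is essential and
    \<open>y\<close> is not, so \<open>z\<close> stays essential without \<open>y\<close>.
    Exchanging \<open>x\<close> and \<open>z\<close> gives the second equation.\<close>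
  have "ess (V - {x}) z" using zV d mx mV e by (simp add: ess_def)
  moreover have "\<not> ess (V - {x}) y" using mx xy e by (simp add: ess_def)
  ultimately have "ess (V - {x} - {y}) z" using ess_del[of "V - {x}" z y] V yV d by simp
  then have 1: "m (V - {x, y}) = m (V - {x, y, z}) + 1" using e by (simp add: ess_def)
  have "ess (V - {z}) x" using xV d mz mV e by (simp add: ess_def)
  moreover have "\<not> ess (V - {z}) y" using mz yz e by (simp add: ess_def)
  ultimately have "ess (V - {z} - {y}) x" using ess_del[of "V - {z}" x y] V yV d by simp
  then have 2: "m (V - {y, z}) = m (V - {x, y, z}) + 1" using e by (simp add: ess_def)
  \<comment> \<open>Equality would give the orders \<open>2 * ?k + 2\<close> and
    \<open>2 * ?k + 1\<close> for \<open>x\<close> and \<open>z\<close> in \<open>V - {y}\<close>,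
    against parity.\<close>
  have "m (V - {x, y}) \<noteq> ?k + 1"
  proof
    assume eq: "m (V - {x, y}) = ?k + 1"
    have "even (min (m (V - {y} - {x}) + m (V - {y} - {z})) (m (V - {y}) + m (V - {y} - {x, z})))"
      by (rule two_point_parity) (use V xV zV d eq 1 2 my mV in \<open>simp_all add: e\<close>)
    moreover have "m (V - {y}) = ?k + 1" "m (V - {y, z}) = ?k + 1" "m (V - {x, y, z}) = ?k"
      using eq 1 2 my mV by simp_all
    ultimately have "even (min (?k + 1 + (?k + 1)) (?k + 1 + ?k))" using eq by (simp only: e)
    then show False by simp
  qed
  then have "m (V - {x, y}) \<ge> ?k + 2" using xy mV by simp
  then have "2 * (?k + 1) \<le> m (V - {y}) + m (V - {x, z})"
    by (intro three_point_bound[OF V yV xV zV])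
      (use 1 2 mx my mz mV d in \<open>simp_all add: insert_commute\<close>)
  then show False using my mV by simp
qed

text \<open>Call essential vertices \<open>x\<close>, \<open>y\<close> linked if deleting both lowers \<open>m\<close> by at most one. Adjacent
  ones are linked, so in a connected graph all are; but if \<open>m V \<ge> 2\<close>, then deleting \<open>x\<close> leaves an essential
  vertex, which is not linked to \<open>x\<close>.\<close>

lemma gallai_lemma:
  assumes V: "finite V" "V \<noteq> {}" and ess: "\<And>x. x \<in> V \<Longrightarrow> ess V x"
    and conn: "\<And>x y. x \<in> V \<Longrightarrow> y \<in> V \<Longrightarrow> (adj (graph_on E V))\<^sup>*\<^sup>* x y"
  shows "m V = 1"
proof -
  obtain x where x: "x \<in> V" using V by auto
  have link: "x = y \<or> m V \<le> m (V - {x, y}) + 1" if "(adj (graph_on E V))\<^sup>*\<^sup>* x y" for y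
    using that
  proof (induction rule: rtranclp_induct)
    case (step y z)
    have yz: "y \<in> V" "z \<in> V" "E y z" "y \<noteq> z"
      using step.hyps(2) irrefl unfolding adj_def edge_iff by blast+
    have p: "[y, z] \<in> paths V y z" using yz by (simp add: paths_def)
    have "m V = m (V - {y}) + 1" "m V = m (V - {z}) + 1"
      using ess[OF yz(1)] ess[OF yz(2)] by (simp_all only: ess_def)
    moreover have "V - {y} - {z} = V - {y, z}" by auto
    then have "m (V - {y}) \<le> m (V - {y, z}) + 1" using interlacing(1)[of "V - {y}" z] V yz by simp
    \<comment> \<open>The edge itself is a path from \<open>y\<close> to \<open>z\<close>, so the
      path bound shows that adjacent vertices are linked.\<close>
    ultimately have "2 * (m V - 1) \<le> 2 * m (V - set [y, z])"
      using yz by (intro path_mult_bound[OF V(1) yz(1,2,4) _ _ p]) simp_all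
    then have l: "m V \<le> m (V - {y, z}) + 1" by simp
    show ?case
    proof (cases "x = y \<or> x = z")
      case True then show ?thesis using l by auto
    next
      case False
      then show ?thesis using linked_trans[OF V(1) ess[OF x] ess[OF yz(1)] ess[OF yz(2)]] yz(4) l step.IH by blast
    qed
  qed simp
  have mx: "m V = m (V - {x}) + 1" using ess x by (auto simp: ess_def)
  have "m (V - {x}) = 0"
  proof (rule ccontr)
    assume "m (V - {x}) \<noteq> 0"
    then obtain y where y: "ess (V - {x}) y" using ex_ess[of "V - {x}"] V by auto
    have "V - {x} - {y} = V - {x, y}" by auto
    moreover have "y \<in> V" "y \<noteq> x" "m (V - {x}) = m (V - {x} - {y}) + 1" using y by (auto simp: ess_def)
    ultimately show False using link[OF conn[OF x], of y] mx by simp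
  qed
  then show ?thesis using mx by simp
qed

section \<open>Disjoint unions\<close>

lemma match_poly_disjoint_union:
  assumes "finite V" "finite W" "V \<inter> W = {}" "\<And>x y. x \<in> V \<Longrightarrow> y \<in> W \<Longrightarrow> \<not> E x y"
  shows "\<mu> (V \<union> W) = \<mu> V * \<mu> W"
  using assms
proof (induction "card V" arbitrary: V rule: less_induct)
  case less
  show ?case
  proof (cases "V = {}")
    case True then show ?thesis by (simp add: match_poly_empty)
  next
    case False
    then obtain u where u: "u \<in> V" by auto
    have IH: "\<mu> (V - X \<union> W) = \<mu> (V - X) * \<mu> W" if "u \<in> X" for X
    proof (rule less.hyps)
      have "V - X \<subset> V" using u that by auto
      then show "card (V - X) < card V" using less.prems(1) by (rule psubset_card_mono[rotated])
    qed (use less.prems in auto)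
    have e: "V \<union> W - X = V - X \<union> W" if "X \<subseteq> V" for X using less.prems(3) that by auto
    have N: "{c. c \<in> V \<union> W \<and> E u c} = {c. c \<in> V \<and> E u c}" using less.prems(4) u by auto
    have "\<mu> (V \<union> W) = [:0, 1:] * \<mu> (V \<union> W - {u}) - (\<Sum>c | c \<in> V \<and> E u c. \<mu> (V \<union> W - {u, c}))"
      using match_poly_rec[of "V \<union> W" u] less.prems u N by simp
    also have "\<dots> = [:0, 1:] * (\<mu> (V - {u}) * \<mu> W) - (\<Sum>c | c \<in> V \<and> E u c. \<mu> (V - {u, c}) * \<mu> W)"
      using u by (intro arg_cong2[of _ _ _ _ "(-)"] arg_cong2[of _ _ _ _ "(*)"] sum.cong refl)
        (simp_all only: mem_Collect_eq e IH insert_subset empty_subsetI insert_iff simp_thms)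
    also have "\<dots> = ([:0, 1:] * \<mu> (V - {u}) - (\<Sum>c | c \<in> V \<and> E u c. \<mu> (V - {u, c}))) * \<mu> W"
      by (simp only: sum_distrib_right left_diff_distrib mult.assoc)
    also have "\<dots> = \<mu> V * \<mu> W" using match_poly_rec[OF less.prems(1) u] by simp
    finally show ?thesis .
  qed
qed

lemma mult_disjoint_union:
  assumes "finite V" "finite W" "V \<inter> W = {}" "\<And>x y. x \<in> V \<Longrightarrow> y \<in> W \<Longrightarrow> \<not> E x y"
  shows "m (V \<union> W) = m V + m W"
  using match_poly_disjoint_union[OF assms] order_mult_match_poly[OF assms(1,2)] by (simp add: mult_def)

lemma ess_disjoint_union:
  assumes "finite V" "finite W" "V \<inter> W = {}" "\<And>x y. x \<in> V \<Longrightarrow> y \<in> W \<Longrightarrow> \<not> E x y" and x: "x \<in> V"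
  shows "ess (V \<union> W) x \<longleftrightarrow> ess V x"
proof -
  have "V \<union> W - {x} = (V - {x}) \<union> W" using assms(3) x by auto
  moreover have "(V - {x}) \<inter> W = {}" using assms(3) by auto
  ultimately show ?thesis using mult_disjoint_union[OF assms(1-4)] mult_disjoint_union[of "V - {x}" W] assms
    by (simp add: ess_def)
qed

end

section \<open>Adding edges and critical components\<close>

text \<open>The set \<open>B\<close> is a parameter so that the special vertices can be joined to
  everything one at a time.\<close>

definition join_edges :: "('a \<Rightarrow> 'a \<Rightarrow> bool) \<Rightarrow> 'a set \<Rightarrow> 'a \<Rightarrow> 'a \<Rightarrow> bool" where
  "join_edges E B x y \<longleftrightarrow> E x y \<or> x \<noteq> y \<and> (x \<in> B \<or> y \<in> B)"

lemma (in matching_graph) matching_graph_join_edges: "matching_graph (join_edges E B)"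
  by unfold_locales (auto simp: join_edges_def sym irrefl)

context matching_graph_at
begin

text \<open>A special vertex \<open>a\<close> stays positive when it gets more neighbours, because positivity of \<open>a\<close> only
  asks for one neighbour that is essential after deleting \<open>a\<close>.\<close>

lemma ess_add_edges:
  assumes F: "matching_graph F" and V: "finite V"
    and a: "a \<in> V" "\<not> ess V a" and w: "ess V w" "E a w"
    and agree: "\<And>x y. x \<noteq> a \<Longrightarrow> y \<noteq> a \<Longrightarrow> F x y \<longleftrightarrow> E x y" and sub: "\<And>y. E a y \<Longrightarrow> F a y"
  shows "mult \<theta> (graph_on F V) = m V" and "essential \<theta> (graph_on F V) z \<longleftrightarrow> essential \<theta> (graph_on E V) z"
proof -
  interpret F: matching_graph F by (rule F)
  interpret F: matching_graph_at F \<theta> ..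
  have eq: "graph_on F U = graph_on E U" if "a \<notin> U" for U
    using that agree by (intro graph_on_cong) metis
  have ess_eq: "F.ess U c \<longleftrightarrow> ess U c" if "a \<notin> U" for U c
    using eq[OF that] F.essential_iff_ess essential_iff_ess by metis
  \<comment> \<open>Where deleting \<open>a\<close> raises the multiplicity in both graphs, that of
    \<open>U\<close> is one less than that of \<open>U - {a}\<close>, on which the graphs
    agree.\<close>
  have same: "F.m U = m U" if U: "finite U" "a \<in> U" "m (U - {a}) = m U + 1" for U
  proof -
    obtain c where c: "c \<in> U" "E a c" "ess (U - {a}) c" using positive_iff[OF U(1,2)] U(3) by blast
    then have "F.m (U - {a}) = F.m U + 1"
      using F.positive_iff[OF U(1,2)] sub ess_eq[of "U - {a}"] by blast
    then show ?thesis using eq[of "U - {a}"] U(3) by simp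
  qed
  have ma: "m (V - {a}) = m V + 1" using special_positive[OF V a w] .
  show mV: "F.m V = m V" using same[OF V a(1) ma] .
  have imp: "F.ess V z" if z: "ess V z" for z
  proof -
    have za: "z \<in> V" "z \<noteq> a" using z a by (auto simp: ess_def)
    have e: "V - {z} - {a} = V - {a} - {z}" by auto
    have "ess (V - {a}) z" using ess_del[OF V z a] .
    \<comment> \<open>Deleting \<open>a\<close> still raises the multiplicity in
      \<open>V - {z}\<close>, so \<open>same\<close> applies there too.\<close>
    then have "m (V - {z} - {a}) = m (V - {z}) + 1" using z ma unfolding e by (simp add: ess_def)
    then have "F.m (V - {z}) = m (V - {z})" using same[of "V - {z}"] V a(1) za by simp
    then show ?thesis using z mV by (simp add: ess_def F.ess_def)
  qed
  have Fa: "\<not> F.ess V a" using ma mV eq[of "V - {a}"] by (simp add: F.ess_def)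
  \<comment> \<open>Stability moves the question to \<open>V - {a}\<close> in both graphs, where
    they coincide.\<close>
  have "F.ess V z \<longleftrightarrow> ess V z"
    using F.ess_del_special[OF V a(1) Fa imp[OF w(1)] sub[OF w(2)]] ess_del_special[OF V a w]
      ess_eq[of "V - {a}"] by blast
  then show "essential \<theta> (graph_on F V) z \<longleftrightarrow> essential \<theta> (graph_on E V) z"
    by (simp add: F.essential_iff_ess essential_iff_ess)
qed

text \<open>Every step leaves the essential vertices unchanged, so the next vertex of
  \<open>B\<close> is still special in the graph built so far and \<open>ess_add_edges\<close>
  applies again.\<close>

lemma ess_join_edges:
  assumes V: "finite V" and B: "B \<subseteq> V" "\<And>a. a \<in> B \<Longrightarrow> \<not> ess V a \<and> (\<exists>w. ess V w \<and> E a w)"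
  shows "mult \<theta> (graph_on (join_edges E B) V) = m V \<and>
    (\<forall>z. essential \<theta> (graph_on (join_edges E B) V) z \<longleftrightarrow> ess V z)"
proof -
  have "finite B" using V B finite_subset by blast
  then show ?thesis using B
  proof (induction B rule: finite_induct)
    case empty
    have "join_edges E {} = E" by (intro ext) (simp add: join_edges_def)
    then show ?case by (simp add: essential_iff_ess)
  next
    case (insert a B)
    have IH: "mult \<theta> (graph_on (join_edges E B) V) = m V"
      "\<And>z. essential \<theta> (graph_on (join_edges E B) V) z \<longleftrightarrow> ess V z" using insert by auto
    interpret B: matching_graph "join_edges E B" by (rule matching_graph_join_edges)
    interpret B: matching_graph_at "join_edges E B" \<theta> ..
    have B_ess: "B.ess V z \<longleftrightarrow> ess V z" for z using IH(2) B.essential_iff_ess by blast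
    obtain w where w: "ess V w" "E a w" using insert.prems by auto
    have s: "a \<in> V" "\<not> B.ess V a" "B.ess V w" "join_edges E B a w"
      using insert.prems w B_ess by (auto simp: join_edges_def)
    have "mult \<theta> (graph_on (join_edges E (insert a B)) V) = mult \<theta> (graph_on (join_edges E B) V)"
      "\<And>z. essential \<theta> (graph_on (join_edges E (insert a B)) V) z \<longleftrightarrow> essential \<theta> (graph_on (join_edges E B) V) z"
      by (rule B.ess_add_edges[OF matching_graph_join_edges V s]; auto simp: join_edges_def)+
    then show ?case using IH by simp
  qed
qed

section \<open>Components after deletion of the special vertices\<close>

definition specials :: "'a set \<Rightarrow> 'a set" where
  "specials V = {a \<in> V. \<not> ess V a \<and> (\<exists>w. ess V w \<and> E a w)}"

definition component_of :: "'a set \<Rightarrow> 'a \<Rightarrow> 'a set" where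
  "component_of V u = {y \<in> V. (adj (graph_on E V))\<^sup>*\<^sup>* u y}"

lemma adj_graph_on: "adj (graph_on E V) x y \<longleftrightarrow> x \<in> V \<and> y \<in> V \<and> E x y"
  by (simp add: adj_def edge_iff)

lemma symp_reachable: "(adj (graph_on E V))\<^sup>*\<^sup>* x y \<Longrightarrow> (adj (graph_on E V))\<^sup>*\<^sup>* y x"
proof (induction rule: rtranclp_induct)
  case (step y z)
  then have "adj (graph_on E V) z y" using sym by (simp add: adj_graph_on)
  then show ?case using step.IH by (rule converse_rtranclp_into_rtranclp)
qed simp

lemma comp_closed: "x \<in> component_of V u \<Longrightarrow> y \<in> V \<Longrightarrow> E x y \<Longrightarrow> y \<in> component_of V u"
  unfolding component_of_def using rtranclp.rtrancl_into_rtrancl[of "adj (graph_on E V)" u x y]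
  by (simp add: adj_graph_on)

lemma comp_self: "u \<in> V \<Longrightarrow> u \<in> component_of V u" and comp_subset: "component_of V u \<subseteq> V"
  by (auto simp: component_of_def)

lemma comp_eq: "x \<in> component_of V u \<Longrightarrow> component_of V x = component_of V u"
  unfolding component_of_def using rtranclp_trans[of "adj (graph_on E V)"] symp_reachable[of V] by blast

lemma comp_connected:
  assumes "u \<in> V" "x \<in> component_of V u" "y \<in> component_of V u"
  shows "(adj (graph_on E (component_of V u)))\<^sup>*\<^sup>* x y"
proof -
  have *: "(adj (graph_on E (component_of V u)))\<^sup>*\<^sup>* u z" if "(adj (graph_on E V))\<^sup>*\<^sup>* u z" for z
    using that
  proof (induction rule: rtranclp_induct)
    case (step y z)
    have yz: "y \<in> V" "z \<in> V" "E y z" using step.hyps(2) by (simp_all add: adj_graph_on)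
    then have "y \<in> component_of V u" using step.hyps(1) by (simp add: component_of_def)
    then have "adj (graph_on E (component_of V u)) y z"
      using comp_closed yz by (simp add: adj_graph_on)
    then show ?case using step.IH by (rule rtranclp.rtrancl_into_rtrancl[rotated])
  qed simp
  have "(adj (graph_on E (component_of V u)))\<^sup>*\<^sup>* u x" "(adj (graph_on E (component_of V u)))\<^sup>*\<^sup>* u y"
    using assms * unfolding component_of_def by blast+
  then show ?thesis using rtranclp_trans[OF symp_reachable[of "component_of V u" u x]] by blast
qed

lemma ess_comp:
  assumes V: "finite V" and x: "x \<in> component_of V u"
  shows "ess (component_of V u) x \<longleftrightarrow> ess V x"
proof -
  have V': "component_of V u \<union> (V - component_of V u) = V" using comp_subset by blast
  have "ess (component_of V u \<union> (V - component_of V u)) x \<longleftrightarrow> ess (component_of V u) x"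
  proof (rule ess_disjoint_union[OF _ _ _ _ x])
    show "finite (component_of V u)" using finite_subset[OF comp_subset V] .
    show "\<not> E y z" if "y \<in> component_of V u" "z \<in> V - component_of V u" for y z
      using that comp_closed[of y V u z] by blast
  qed (use V in auto)
  then show ?thesis unfolding V' by simp
qed

lemma ess_del_all_specials:
  assumes "finite V" shows "ess (V - specials V) z \<longleftrightarrow> ess V z"
proof -
  have "specials V \<subseteq> V" "\<And>a. a \<in> specials V \<Longrightarrow> \<not> ess V a \<and> (\<exists>w. ess V w \<and> E a w)"
    unfolding specials_def by blast+
  then show ?thesis using ess_del_specials[OF assms] by blast
qed

text \<open>A nonessential neighbour of an essential vertex is special. Once the special vertices
  are gone, being essential therefore spreads along edges.\<close>

lemma ess_in_comp:
  assumes V: "finite V" and u: "ess V u" and x: "x \<in> component_of (V - specials V) u"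
  shows "ess V x"
proof -
  have "(adj (graph_on E (V - specials V)))\<^sup>*\<^sup>* u x" using x by (simp add: component_of_def)
  then show ?thesis
  proof (induction rule: rtranclp_induct)
    case base then show ?case by (rule u)
  next
    case (step y z)
    then have "E z y" "z \<in> V" "z \<notin> specials V" using sym[of y z] by (simp_all add: adj_graph_on)
    then show ?case using step.IH unfolding specials_def by blast
  qed
qed

text \<open>All vertices of this component are essential, in the component as well as in
  \<open>V\<close>, so Gallai's lemma applies.\<close>

lemma mult_comp:
  assumes V: "finite V" and u: "ess V u"
  shows "m (component_of (V - specials V) u) = 1"
proof (rule gallai_lemma)
  have uH: "u \<in> V - specials V" using u by (auto simp: ess_def specials_def)
  show "finite (component_of (V - specials V) u)" using V comp_subset finite_subset by blast
  show "component_of (V - specials V) u \<noteq> {}" using comp_self[OF uH] by auto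
  show "ess (component_of (V - specials V) u) x" if "x \<in> component_of (V - specials V) u" for x
    using ess_comp[OF _ that] ess_del_all_specials[OF V, of x] ess_in_comp[OF V u that] V by simp
  show "(adj (graph_on E (component_of (V - specials V) u)))\<^sup>*\<^sup>* x y"
    if "x \<in> component_of (V - specials V) u" "y \<in> component_of (V - specials V) u" for x y
    using comp_connected[OF uH that] .
qed

text \<open>Deleting \<open>u\<close> brings the multiplicity of its component from 1 to 0, so no
  essential vertex remains there; the other components are unaffected.\<close>

lemma ess_del_two:
  assumes V: "finite V" and u: "ess V u"
  shows "ess (V - specials V - {u}) v \<longleftrightarrow> ess V v \<and> v \<notin> component_of (V - specials V) u"
proof -
  let ?H = "V - specials V"
  let ?C = "component_of ?H u" and ?D = "?H - component_of ?H u"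
  have uH: "u \<in> ?H" using u by (auto simp: ess_def specials_def)
  note uC = comp_self[OF uH]
  have fin: "finite ?C" "finite ?D" "finite (?C - {u})" using V comp_subset finite_subset by (blast, blast, blast)
  have CD: "?H - {u} = (?C - {u}) \<union> ?D" using uC comp_subset[of ?H u] by blast
  have H: "?H = ?D \<union> ?C" using comp_subset[of ?H u] by blast
  have no: "\<not> E x y" "\<not> E y x" if "x \<in> ?C" "y \<in> ?D" for x y
    using that comp_closed[of x ?H u y] sym[of y x] by blast+
  have "ess ?C u" using ess_comp[OF _ uC] ess_del_all_specials[OF V] u V by simp
  then have m0: "m (?C - {u}) = 0" using mult_comp[OF V u] by (simp add: ess_def)
  consider "v \<in> ?C - {u}" | "v \<in> ?D" | "v \<notin> ?H - {u}" using CD by blast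
  then show ?thesis
  proof cases
    case 1
    then have "ess (?H - {u}) v \<longleftrightarrow> ess (?C - {u}) v"
      unfolding CD using fin no by (intro ess_disjoint_union) auto
    then show ?thesis using 1 m0 by (simp add: ess_def)
  next
    case 2
    have "ess (?H - {u}) v \<longleftrightarrow> ess (?D \<union> (?C - {u})) v" unfolding CD by (simp only: Un_commute)
    also have "\<dots> \<longleftrightarrow> ess ?D v" using fin no 2 by (intro ess_disjoint_union) auto
    \<comment> \<open>Outside the component of \<open>u\<close> it makes no difference whether that
      component is absent, complete or without \<open>u\<close>.\<close>
    also have "\<dots> \<longleftrightarrow> ess (?D \<union> ?C) v" using fin no 2 by (intro ess_disjoint_union[symmetric]) auto
    also have "\<dots> \<longleftrightarrow> ess V v" using H ess_del_all_specials[OF V] by simp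
    finally show ?thesis using 2 by simp
  next
    case 3
    then have "\<not> ess (?H - {u}) v" using ess_in by blast
    moreover have "v \<notin> ?C \<longrightarrow> \<not> ess V v"
      using 3 uC ess_in[of V v] unfolding specials_def by blast
    ultimately show ?thesis by blast
  qed
qed

lemma join_specials:
  assumes V: "finite V" and m2: "m V \<ge> 2" and uv: "u \<in> V" "v \<in> V" "u \<noteq> v"
  defines "S \<equiv> join_edges E (specials V)"
  shows "mult \<theta> (graph_on S (V - {u, v})) + 2 = mult \<theta> (graph_on S V) \<longleftrightarrow>
    ess V u \<and> ess V v \<and> v \<notin> component_of (V - specials V) u"
proof -
  interpret S: matching_graph S unfolding S_def by (rule matching_graph_join_edges)
  interpret S: matching_graph_at S \<theta> ..
  let ?A = "specials V"
  have A: "?A \<subseteq> V" "\<And>a. a \<in> ?A \<Longrightarrow> \<not> ess V a \<and> (\<exists>w. ess V w \<and> E a w)" by (simp_all add: specials_def)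
  have SV: "S.m V = m V" "\<And>z. S.ess V z \<longleftrightarrow> ess V z"
    using ess_join_edges[OF V A] S.essential_iff_ess unfolding S_def by blast+
  have eq: "graph_on S U = graph_on E U" if "U \<inter> ?A = {}" for U
    unfolding S_def join_edges_def using that by (intro graph_on_cong) blast
  have key: "S.ess (V - {u}) v \<longleftrightarrow> ess V v \<and> v \<notin> component_of (V - ?A) u" if u: "ess V u"
  proof -
    let ?W = "V - {u}"
    have W: "finite ?W" using V by simp
    have Su: "S.ess V u" using SV(2) u by blast
    then have mW: "S.m ?W + 1 = m V" using SV(1) by (simp add: S.ess_def)
    \<comment> \<open>Here \<open>m V \<ge> 2\<close> enters: one deletion leaves a positive
      multiplicity and hence an essential vertex.\<close>
    then obtain x where x: "S.ess ?W x" using S.ex_ess[OF W] m2 by auto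
    \<comment> \<open>Since \<open>u\<close> is essential also in \<open>V - {a}\<close>, deleting
      \<open>a\<close> raises the multiplicity of \<open>?W\<close> as it does that of
      \<open>V\<close>.\<close>
    have nA: "\<not> S.ess ?W a" if a: "a \<in> ?A" for a
    proof -
      obtain w where w: "ess V w" "E a w" and aV: "a \<in> V" "\<not> ess V a" using a A by blast
      have s: "a \<in> V" "\<not> S.ess V a" "S.ess V w" "S a w" using w aV SV(2) unfolding S_def join_edges_def by blast+
      have "S.m (V - {a}) = m V + 1" using S.special_positive[OF V s] SV(1) by simp
      moreover have "S.ess (V - {a}) u" using S.ess_del[OF V Su s(1,2)] .
      moreover have "V - {a} - {u} = ?W - {a}" by auto
      ultimately show ?thesis using mW by (simp add: S.ess_def)
    qed
    have "S.ess (?W - ?A) v \<longleftrightarrow> S.ess ?W v"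
    proof -
      have "?A \<subseteq> ?W" using A(1) A(2)[of u] u by blast
      moreover have "\<not> S.ess ?W a \<and> (\<exists>w. S.ess ?W w \<and> S a w)" if "a \<in> ?A" for a
      proof -
        \<comment> \<open>In the joined graph \<open>x\<close> is adjacent to every other vertex of
          \<open>specials V\<close>, which makes all of them special in \<open>?W\<close>.\<close>
        have "x \<noteq> a" using that nA x by blast
        then show ?thesis using that nA x unfolding S_def join_edges_def by blast
      qed
      ultimately show ?thesis using S.ess_del_specials[OF W] by blast
    qed
    moreover have "?W - ?A = V - ?A - {u}" by auto
    moreover have "graph_on S (V - ?A - {u}) = graph_on E (V - ?A - {u})" by (rule eq) blast
    then have "S.ess (V - ?A - {u}) v \<longleftrightarrow> ess (V - ?A - {u}) v"
      using S.essential_iff_ess[of "V - ?A - {u}" v] essential_iff_ess[of "V - ?A - {u}" v] by simp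
    ultimately show ?thesis using ess_del_two[OF V u] by simp
  qed
  have e: "V - {u} - {v} = V - {u, v}" by auto
  \<comment> \<open>Each deletion lowers the multiplicity by at most one, so a drop of two means
    that both deletions lower it.\<close>
  have "S.m V \<le> S.m (V - {u}) + 1" "S.m (V - {u}) \<le> S.m (V - {u, v}) + 1"
    using S.interlacing(1)[OF V uv(1)] S.interlacing(1)[of "V - {u}" v] V uv unfolding e by simp_all
  then have "S.m (V - {u, v}) + 2 = S.m V \<longleftrightarrow> S.ess V u \<and> S.ess (V - {u}) v"
    unfolding S.ess_def e using uv by auto
  then show ?thesis using key SV by blast
qed

section \<open>Translation to the given definitions\<close>

lemma A_set_graph_on: "A_set \<theta> (graph_on E V) = specials V"
  unfolding A_set_def special_def specials_def essential_iff_ess edge_iff verts_graph_on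
  using ess_in by blast

lemma components_graph_on: "components (graph_on E V) = component_of V ` V"
  unfolding components_def component_of_def verts_graph_on by blast

text \<open>By stability and locality, being essential in a component of the graph without special
  vertices is the same as being essential in \<open>V\<close>, and one such vertex makes its whole
  component critical.\<close>

lemma crit_comps_iff:
  assumes V: "finite V"
  shows "C \<in> crit_comps \<theta> (graph_on E V) \<and> u \<in> C \<longleftrightarrow> ess V u \<and> C = component_of (V - specials V) u"
proof -
  let ?H = "V - specials V"
  have "critical \<theta> (induced (graph_on E ?H) (component_of ?H x)) \<longleftrightarrow>
      (\<forall>y\<in>component_of ?H x. ess (component_of ?H x) y)" if "x \<in> ?H" for x
    unfolding induced_graph_on[OF comp_subset] critical_def connected_graph_def essential_iff_ess verts_graph_on
    using comp_connected[OF that] comp_self[OF that] by blast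
  then have crit: "C \<in> crit_comps \<theta> (graph_on E V) \<longleftrightarrow>
      (\<exists>x\<in>?H. C = component_of ?H x \<and> (\<forall>y\<in>C. ess C y))"
    unfolding crit_comps_def A_set_graph_on del_graph_on components_graph_on by auto
  have fH: "finite ?H" using V by simp
  show ?thesis
  proof
    assume C: "C \<in> crit_comps \<theta> (graph_on E V) \<and> u \<in> C"
    then obtain x where x: "C = component_of ?H x" "ess C u" using crit by blast
    then have "C = component_of ?H u" using C comp_eq by blast
    moreover have "ess ?H u" using ess_comp[OF fH] x C by blast
    ultimately show "ess V u \<and> C = component_of ?H u" using ess_del_all_specials[OF V] by simp
  next
    assume C: "ess V u \<and> C = component_of ?H u"
    then have uH: "u \<in> ?H" by (auto simp: ess_def specials_def)
    have "ess C y" if "y \<in> C" for y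
      using C that ess_comp[OF fH] ess_del_all_specials[OF V] ess_in_comp[OF V] by blast
    then show "C \<in> crit_comps \<theta> (graph_on E V) \<and> u \<in> C" using crit uH C comp_self by blast
  qed
qed

end

theorem theorem5p4:
  fixes G :: "'a graph" and \<theta> :: real and u v :: 'a
  assumes "graph G"
    and "mult \<theta> G \<ge> 2"
    and "u \<in> verts G" and "v \<in> verts G" and "u \<noteq> v"
  shows "int (mult \<theta> (del (S_graph \<theta> G) {u, v})) = int (mult \<theta> (S_graph \<theta> G)) - 2
     \<longleftrightarrow> (\<exists>Hi\<in>crit_comps \<theta> G. \<exists>Hj\<in>crit_comps \<theta> G. Hi \<noteq> Hj \<and> u \<in> Hi \<and> v \<in> Hj)"
proof -
  let ?V = "verts G"
  have V: "finite ?V" using assms(1) by (simp add: graph_def)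
  have ex: "\<exists>a b. a \<noteq> b \<and> a \<in> ?V \<and> b \<in> ?V \<and> e = {a, b}" if "e \<in> edges G" for e
    using assms(1) that unfolding graph_def by (elim conjE) (erule (1) bspec)
  have edge: "x \<noteq> y \<and> x \<in> ?V \<and> y \<in> ?V" if xy: "{x, y} \<in> edges G" for x y
  proof -
    obtain a b where ab: "a \<noteq> b" "a \<in> ?V" "b \<in> ?V" "{x, y} = {a, b}" using ex[OF xy] by (elim exE conjE)
    from ab(4) have "x = a \<and> y = b \<or> x = b \<and> y = a" by (simp only: doubleton_eq_iff)
    then show ?thesis using ab(1-3) by (elim disjE conjE) simp_all
  qed
  interpret matching_graph "adj G"
  proof
    show "adj G y x" if "adj G x y" for x y using that by (simp add: adj_def insert_commute)
    show "\<not> adj G x x" for x using edge[of x x] by (auto simp: adj_def)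
  qed
  interpret matching_graph_at "adj G" \<theta> ..
  have edgesG: "edges G = {{x, y} | x y. x \<in> ?V \<and> y \<in> ?V \<and> adj G x y}"
  proof (intro equalityI subsetI)
    fix e assume e: "e \<in> edges G"
    then obtain x y where "x \<in> ?V" "y \<in> ?V" "e = {x, y}" using ex[OF e] by (elim exE conjE)
    then show "e \<in> {{x, y} | x y. x \<in> ?V \<and> y \<in> ?V \<and> adj G x y}" using e unfolding adj_def by blast
  qed (auto simp: adj_def)
  have "G = (verts G, edges G)" by (simp add: verts_def edges_def)
  \<comment> \<open>A graph is determined by its vertices and its adjacency relation; this equation
    carries the results on \<open>graph_on\<close> over to \<open>G\<close>.\<close>
  then have G: "G = graph_on (adj G) ?V" unfolding edgesG graph_on_def .
  let ?S = "join_edges (adj G) (specials ?V)"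
  have A: "A_set \<theta> G = specials ?V" by (rule A_set_graph_on[of ?V, unfolded G[symmetric]])
  have "edges (S_graph \<theta> G) = edges (graph_on ?S ?V)"
  proof (rule set_eqI, rule iffI)
    fix e assume "e \<in> edges (S_graph \<theta> G)"
    then consider "e \<in> edges G" | w z where "w \<in> specials ?V" "z \<in> ?V" "z \<noteq> w" "e = {w, z}"
      unfolding S_graph_def edges_def A snd_conv by blast
    then show "e \<in> edges (graph_on ?S ?V)"
    proof cases
      case 1
      then obtain x y where "x \<in> ?V" "y \<in> ?V" "adj G x y" "e = {x, y}" unfolding edgesG by blast
      then show ?thesis unfolding edges_graph_on join_edges_def by blast
    next
      case 2
      then show ?thesis unfolding edges_graph_on join_edges_def specials_def by blast
    qed
  next
    fix e assume "e \<in> edges (graph_on ?S ?V)"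
    then obtain x y where e: "x \<in> ?V" "y \<in> ?V" "?S x y" "e = {x, y}" unfolding edges_graph_on by blast
    then consider "e \<in> edges G" | "x \<in> specials ?V" "y \<noteq> x" | "y \<in> specials ?V" "x \<noteq> y"
      unfolding join_edges_def adj_def by blast
    then show "e \<in> edges (S_graph \<theta> G)"
      unfolding S_graph_def edges_def A snd_conv using e by cases (blast, blast, blast)
  qed
  moreover have "verts (S_graph \<theta> G) = verts (graph_on ?S ?V)" by (simp add: S_graph_def verts_def graph_on_def)
  ultimately have S: "S_graph \<theta> G = graph_on ?S ?V" by (simp only: verts_def edges_def prod_eq_iff)
  have c: "C \<in> crit_comps \<theta> G \<and> x \<in> C \<longleftrightarrow> ess ?V x \<and> C = component_of (?V - specials ?V) x" for C x
    by (rule crit_comps_iff[OF V, unfolded G[symmetric]])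
  have "int (mult \<theta> (del (S_graph \<theta> G) {u, v})) = int (mult \<theta> (S_graph \<theta> G)) - 2 \<longleftrightarrow>
      mult \<theta> (graph_on ?S (?V - {u, v})) + 2 = mult \<theta> (graph_on ?S ?V)"
    unfolding S del_graph_on by linarith
  also have "\<dots> \<longleftrightarrow> ess ?V u \<and> ess ?V v \<and> v \<notin> component_of (?V - specials ?V) u"
    using assms(2) by (intro join_specials[OF V _ assms(3-5)]) (simp only: G[symmetric])
  \<comment> \<open>As \<open>v\<close> lies in its own component, the two components agree exactly
    if \<open>v\<close> lies in that of \<open>u\<close>.\<close>
  also have "\<dots> \<longleftrightarrow> ess ?V u \<and> ess ?V v \<and> component_of (?V - specials ?V) u \<noteq> component_of (?V - specials ?V) v"
  proof -
    have "v \<in> component_of (?V - specials ?V) v" if "ess ?V v"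
      using that comp_self[of v "?V - specials ?V"] ess_in[OF that] unfolding specials_def by blast
    then show ?thesis using comp_eq[of v "?V - specials ?V" u] by metis
  qed
  also have "\<dots> \<longleftrightarrow> (\<exists>Hi\<in>crit_comps \<theta> G. \<exists>Hj\<in>crit_comps \<theta> G. Hi \<noteq> Hj \<and> u \<in> Hi \<and> v \<in> Hj)"
    using c[of _ u] c[of _ v] by blast
  finally show ?thesis .
qed

end
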